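(* Let $X$ be a primitive distance-regular graph of diameter $d$ such that, for every vertex $v$ of $X$, the subgraph $X[\Gamma_d(v)]$ of $X$ induced by the set of vertices at distance $d$ from $v$ is connected. Then any retraction from $X$ to a subgraph of $X$ of diameter $d$ is an automorphism of $X$.
   Context: Graphs are finite and simple. A connected graph $X$ of diameter $d$ is distance-regular if there are numbers $b_i,c_i$ such that for any two vertices $u,v$ at distance $i$, exactly $c_i$ neighbours of $v$ are at distance $i-1$ from $u$ and exactly $b_i$ neighbours of $v$ are at distance $i+1$ from $u$. For $i\in\{1,\dots,d\}$ the distance graph $X_i$ has vertex set $V(X)$, with two vertices adjacent if and only if they are at distance $i$ in $X$. The distance-regular graph $X$ is primitive if $X_1,\dots,X_d$ are all connected. $\Gamma_i(v)$ is the set of vertices at distance $i$ from $v$ in $X$, and $X[S]$ is the subgraph of $X$ induced by $S\subseteq V(X)$. A homomorphism is a vertex map sending adjacent vertices to adjacent vertices. A retraction of $X$ is a homomorphism $\phi$ from $X$ to a subgraph $Y$ of $X$ whose restriction to $V(Y)$ is the identity map. *)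

theory Defs
  imports "Graph_Theory.Graph_Theory" "HOL-Library.Extended_Nat"
begin

(* Finite simple graphs are rendered by the locale pair_graph: a finite vertex set with a finite,
   symmetric, loop-free set of arcs, so that an edge uv is the pair of arcs (u,v), (v,u). *)

(* The library's shortest-path cost for unit weights, but with values in enat. The infimum over the
   empty set is infinity, the distance of vertices that are not joined by a walk. *)
definition gdist :: "'a pair_pre_digraph \<Rightarrow> 'a \<Rightarrow> 'a \<Rightarrow> enat" where
  "gdist X u v = (INF p \<in> {p. pre_digraph.awalk (with_proj X) u p v}. enat (length p))"

(* A graph whose diameter is enat d is in particular connected if it has a vertex. *)
definition gdiameter :: "'a pair_pre_digraph \<Rightarrow> enat" where
  "gdiameter X = (SUP u \<in> pverts X. SUP v \<in> pverts X. gdist X u v)"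

definition gneighbours :: "'a pair_pre_digraph \<Rightarrow> 'a \<Rightarrow> 'a set" where
  "gneighbours X v = {w. (v, w) \<in> parcs X}"

definition gsphere :: "'a pair_pre_digraph \<Rightarrow> nat \<Rightarrow> 'a \<Rightarrow> 'a set" where
  "gsphere X i v = {w \<in> pverts X. gdist X v w = enat i}"

(* "At distance i - 1 from u" is written gdist X u w + 1 = enat i, so that there are no such
   vertices w for i = 0. *)
definition distance_regular :: "'a pair_pre_digraph \<Rightarrow> bool" where
  "distance_regular X \<longleftrightarrow>
     pair_graph X \<and> Digraph_Component.connected (with_proj X) \<and>
     (\<exists>b c :: nat \<Rightarrow> nat. \<forall>i. \<forall>u \<in> pverts X. \<forall>v \<in> pverts X. gdist X u v = enat i \<longrightarrow>
        card {w \<in> gneighbours X v. gdist X u w + 1 = enat i} = c i \<and>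
        card {w \<in> gneighbours X v. gdist X u w = enat (i + 1)} = b i)"

definition distance_graph :: "'a pair_pre_digraph \<Rightarrow> nat \<Rightarrow> 'a pair_pre_digraph" where
  "distance_graph X i =
     \<lparr> pverts = pverts X,
       parcs = {(u, v). u \<in> pverts X \<and> v \<in> pverts X \<and> gdist X u v = enat i} \<rparr>"

definition primitive_distance_regular :: "'a pair_pre_digraph \<Rightarrow> bool" where
  "primitive_distance_regular X \<longleftrightarrow>
     distance_regular X \<and>
     (\<forall>i. 1 \<le> i \<and> enat i \<le> gdiameter X \<longrightarrow>
        Digraph_Component.connected (with_proj (distance_graph X i)))"

definition graph_hom :: "'a pair_pre_digraph \<Rightarrow> 'b pair_pre_digraph \<Rightarrow> ('a \<Rightarrow> 'b) \<Rightarrow> bool" where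
  "graph_hom X Y f \<longleftrightarrow>
     (\<forall>u \<in> pverts X. f u \<in> pverts Y) \<and>
     (\<forall>u v. (u, v) \<in> parcs X \<longrightarrow> (f u, f v) \<in> parcs Y)"

(* The subgraph Y need not be induced, and its diameter is measured within Y. *)
definition graph_retraction :: "'a pair_pre_digraph \<Rightarrow> 'a pair_pre_digraph \<Rightarrow> ('a \<Rightarrow> 'a) \<Rightarrow> bool" where
  "graph_retraction X Y f \<longleftrightarrow>
     pair_graph Y \<and> subgraph (with_proj Y) (with_proj X) \<and>
     graph_hom X Y f \<and> (\<forall>y \<in> pverts Y. f y = y)"

(* Isomorphisms of the library are records of a vertex map and an arc map; here the arc map is
   determined by the vertex map. *)
definition graph_automorphism :: "'a pair_pre_digraph \<Rightarrow> ('a \<Rightarrow> 'a) \<Rightarrow> bool" where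
  "graph_automorphism X f \<longleftrightarrow>
     bij_betw f (pverts X) (pverts X) \<and>
     (\<forall>u \<in> pverts X. \<forall>v \<in> pverts X. (u, v) \<in> parcs X \<longleftrightarrow> (f u, f v) \<in> parcs X)"

end

theory Submission
  imports Defs "HOL-Analysis.Convex" "HOL-Analysis.Elementary_Metric_Spaces"
begin

text \<open>
  Distances measured in a retract agree with distances in \<open>X\<close>, so \<open>Y\<close> contains two vertices at
  distance \<open>d\<close> in \<open>X\<close>, and \<open>\<phi>\<close> fixes both. The proof shows that such an antipodal pair whose distance
  survives under \<open>\<phi>\<close> forces \<open>\<phi>\<close> to be an isometry; being an injective self-map of a finite graph, it
  is then an automorphism. Any endomorphism that keeps one antipodal pair antipodal is covered
  (\<open>hom_isometry\<close>).

  The engine is spectral. Let \<open>\<theta>\<close> be the least eigenvalue of the adjacency matrix \<open>A\<close>. There is a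
  matrix \<open>M(u, v) = g(D u v)\<close>, depending on the distance \<open>D u v\<close> only, with \<open>A M = \<theta> M\<close>, and the
  signs of \<open>g 0, \<dots>, g d\<close> strictly alternate. Pull the columns of \<open>M\<close> back along \<open>\<phi>\<close> to
  \<open>f\<^sub>x(w) = g(D (\<phi> w) x)\<close>. Since \<open>M\<^sup>2\<close> is again constant on the pairs at each distance and \<open>\<phi>\<close> maps
  edges to edges, the quadratic forms \<open>\<langle>f\<^sub>x, (A - \<theta>) f\<^sub>x\<rangle>\<close> sum over \<open>x\<close> to the same value as for the
  identity map, which is zero. They are all nonnegative, so each of them vanishes and every \<open>f\<^sub>x\<close> is
  itself an eigenvector for \<open>\<theta>\<close> (\<open>eigenvector_pullback\<close>).

  Let \<open>d > 0\<close>, \<open>D v u = d\<close> and \<open>D (\<phi> v) (\<phi> u) = d\<close>. The eigenvector equation of \<open>f\<^sub>x\<close> for \<open>x = \<phi> v\<close> at \<open>u\<close>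
  involves only \<open>g (d - 1)\<close> and \<open>g d\<close>, which differ; so it determines the number of
  neighbours of \<open>u\<close> whose images are at distance \<open>d - 1\<close> from \<open>\<phi> v\<close>, and this number is \<open>c\<^sub>d\<close>. The \<open>c\<^sub>d\<close>
  neighbours of \<open>u\<close> at distance \<open>d - 1\<close> from \<open>v\<close> already account for all of them. Therefore the neighbours of
  \<open>u\<close> at distance \<open>d\<close> from \<open>v\<close> keep this distance (\<open>hom_keeps_antipodal_neighbours\<close>). Connectedness of
  \<open>X[\<Gamma>\<^sub>d(v)]\<close> spreads this to all of \<open>\<Gamma>\<^sub>d(v)\<close>, and connectedness of \<open>X\<^sub>d\<close> spreads it to all antipodal pairs. As
  every geodesic extends to one of length \<open>d\<close>, all distances are kept.

  The spectral facts have elementary proofs. The alternating sequence \<open>g\<close> comes from a Sturm argument on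
  the tridiagonal matrix of intersection numbers (\<open>jacobi_positive_eigenvector\<close>). That its eigenvalue
  is the least one of \<open>A\<close> follows from the power method: powers of \<open>b\<^sub>0 - A\<close> applied to a point mass
  are dominated by \<open>\<bar>g\<bar>\<close> times powers of \<open>b\<^sub>0 - \<theta>\<close> (\<open>rayleigh_bound\<close>).
\<close>

section \<open>Positive eigenvectors of tridiagonal matrices\<close>

text \<open>
  Row \<open>i\<close> of the eigenvector equation with eigenvalue \<open>x\<close> for the tridiagonal matrix with diagonal \<open>\<alpha>\<close>,
  superdiagonal \<open>\<beta>\<close> and subdiagonal \<open>\<gamma>\<close>, solved for entry \<open>i + 1\<close>. Up to the factors \<open>1 / \<beta> i\<close> these are
  the characteristic polynomials of the leading principal submatrices. The index \<open>i - 1\<close> at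
  \<open>i = 0\<close> is harmless when \<open>\<gamma> 0 = 0\<close>.
\<close>
fun sturm :: "(nat \<Rightarrow> real) \<Rightarrow> (nat \<Rightarrow> real) \<Rightarrow> (nat \<Rightarrow> real) \<Rightarrow> nat \<Rightarrow> real \<Rightarrow> real" where
  "sturm \<alpha> \<beta> \<gamma> 0 x = 1"
| "sturm \<alpha> \<beta> \<gamma> (Suc i) x =
     ((x - \<alpha> i) * sturm \<alpha> \<beta> \<gamma> i x - \<gamma> i * sturm \<alpha> \<beta> \<gamma> (i - 1) x) / \<beta> i"

lemma continuous_on_sturm: "continuous_on UNIV (sturm \<alpha> \<beta> \<gamma> i)"
proof (induction i rule: less_induct)
  case (less i)
  show ?case
  proof (cases i)
    case 0
    then show ?thesis by (simp add: fun_eq_iff[of "sturm \<alpha> \<beta> \<gamma> 0" "\<lambda>_. 1", THEN iffD2])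
  next
    case (Suc j)
    have "continuous_on UNIV (\<lambda>x. ((x - \<alpha> j) * sturm \<alpha> \<beta> \<gamma> j x - \<gamma> j * sturm \<alpha> \<beta> \<gamma> (j - 1) x) * (1 / \<beta> j))"
      using less[of j] less[of "j - 1"] Suc by (intro continuous_intros) auto
    then show ?thesis by (simp add: Suc fun_eq_iff[THEN iffD2])
  qed
qed

text \<open>
  To the right of the largest number \<open>\<mu>\<close> at which one of the polynomials of the recurrence is
  nonpositive, all of them are positive, so at \<open>\<mu>\<close> all are nonnegative and one vanishes. A zero in
  the middle of the sequence would force its predecessor to vanish too, down to the constant
  polynomial \<open>1\<close>. Hence only the last polynomial vanishes at \<open>\<mu>\<close>, which is the last row of the
  eigenvector equation.
\<close>
lemma jacobi_positive_eigenvector: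
  fixes \<alpha> \<beta> \<gamma> :: "nat \<Rightarrow> real"
  assumes \<beta>_pos: "\<And>i. i < d \<Longrightarrow> 0 < \<beta> i" and \<beta>_d: "\<beta> d = 0"
    and \<gamma>_pos: "\<And>i. 1 \<le> i \<Longrightarrow> i \<le> d \<Longrightarrow> 0 < \<gamma> i" and \<gamma>_0: "\<gamma> 0 = 0"
  obtains \<mu> G where "G 0 = 1" "\<And>i. i \<le> d \<Longrightarrow> 0 < G i"
    "\<And>i. i \<le> d \<Longrightarrow> \<gamma> i * G (i - 1) + \<alpha> i * G i + \<beta> i * G (Suc i) = \<mu> * G i"
proof -
  \<comment> \<open>The recurrence divides by the superdiagonal, which ends in \<open>0\<close>; with a dummy \<open>1\<close> there, entry
    \<open>d + 1\<close> is a positive multiple of the characteristic polynomial, whose vanishing is the last row.\<close>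
  define \<beta>' where "\<beta>' i = (if i < d then \<beta> i else 1)" for i
  have \<beta>'_pos: "0 < \<beta>' i" for i using \<beta>_pos by (simp add: \<beta>'_def)
  have \<gamma>_nonneg: "0 \<le> \<gamma> i" if "i \<le> d" for i
    using \<gamma>_pos[of i] \<gamma>_0 that by (cases i) auto
  let ?P = "sturm \<alpha> \<beta>' \<gamma>"
  have step: "\<beta>' i * ?P (Suc i) x = (x - \<alpha> i) * ?P i x - \<gamma> i * ?P (i - 1) x" for i x
    using \<beta>'_pos[of i] by simp
  define T where "T = (\<Union>i\<in>{..Suc d}. {x. ?P i x \<le> 0})"
  define B where "B = (\<Sum>i\<le>d. \<bar>\<alpha> i\<bar> + \<bar>\<gamma> i\<bar> + \<beta>' i)"
  have B_ge: "\<alpha> i + \<gamma> i + \<beta>' i \<le> B" if "i \<le> d" for i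
  proof -
    have "\<bar>\<alpha> i\<bar> + \<bar>\<gamma> i\<bar> + \<beta>' i \<le> B"
      unfolding B_def using that \<beta>'_pos
      by (intro member_le_sum[of i "{..d}" "\<lambda>i. \<bar>\<alpha> i\<bar> + \<bar>\<gamma> i\<bar> + \<beta>' i"])
        (auto intro!: add_nonneg_nonneg intro: less_imp_le)
    then show ?thesis by linarith
  qed
  have large: "0 < ?P i x \<and> ?P (i - 1) x \<le> ?P i x" if "i \<le> Suc d" "B \<le> x" for i x
    using that(1)
  proof (induction i)
    case 0
    then show ?case by simp
  next
    case (Suc i)
    then have IH: "0 < ?P i x" "?P (i - 1) x \<le> ?P i x" and i: "i \<le> d" by auto
    have "\<beta>' i * ?P i x \<le> (x - \<alpha> i - \<gamma> i) * ?P i x"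
      using B_ge[OF i] that(2) IH by (intro mult_right_mono) auto
    also have "\<dots> \<le> (x - \<alpha> i) * ?P i x - \<gamma> i * ?P (i - 1) x"
      using mult_left_mono[OF IH(2) \<gamma>_nonneg[OF i]] by (simp add: algebra_simps)
    also have "\<dots> = \<beta>' i * ?P (Suc i) x" by (simp only: step)
    finally have "?P i x \<le> ?P (Suc i) x"
      using \<beta>'_pos[of i] by (simp only: mult_le_cancel_left_pos)
    then show ?case using IH by simp
  qed
  have closed_T: "closed T"
    unfolding T_def using continuous_on_sturm
    by (intro closed_UN ballI closed_Collect_le) auto
  have "?P (Suc 0) (\<alpha> 0) = 0" using \<gamma>_0 by simp
  then have T_ne: "T \<noteq> {}"
    unfolding T_def by (auto simp del: sturm.simps intro!: bexI[of _ "Suc 0"] exI[of _ "\<alpha> 0"])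
  have T_bdd: "x \<le> B" if "x \<in> T" for x
    using that large[of _ x] unfolding T_def by (force simp del: sturm.simps)
  then have bdd: "bdd_above T" by (auto simp: bdd_above_def)
  define \<mu> where "\<mu> = Sup T"
  have "\<mu> \<in> T" unfolding \<mu>_def by (rule closed_contains_Sup[OF T_ne bdd closed_T])
  then obtain j where j: "j \<le> Suc d" "?P j \<mu> \<le> 0" unfolding T_def by auto
  have nonneg: "0 \<le> ?P i \<mu>" if "i \<le> Suc d" for i
  proof (rule tendsto_lowerbound)
    have "continuous (at_right \<mu>) (?P i)"
      using continuous_on_sturm[of \<alpha> \<beta>' \<gamma> i]
      by (simp add: continuous_on_eq_continuous_at continuous_at_imp_continuous_at_within)
    then show "(?P i \<longlongrightarrow> ?P i \<mu>) (at_right \<mu>)"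
      by (simp add: continuous_within)
    have "0 \<le> ?P i x" if "\<mu> < x" for x
    proof -
      have "x \<notin> T" using cSup_upper[OF _ bdd, of x] that unfolding \<mu>_def by force
      then show ?thesis using \<open>i \<le> Suc d\<close> unfolding T_def by force
    qed
    then show "\<forall>\<^sub>F x in at_right \<mu>. 0 \<le> ?P i x"
      by (simp add: eventually_at_right_less eventually_at_filter)
  qed simp
  have no_zero: "?P i \<mu> \<noteq> 0" if "i \<le> d" for i
    using that
  proof (induction i)
    case 0
    then show ?case by simp
  next
    case (Suc i)
    show ?case
    proof
      assume zero: "?P (Suc i) \<mu> = 0"
      have "\<beta>' (Suc i) * ?P (Suc (Suc i)) \<mu> = - (\<gamma> (Suc i) * ?P i \<mu>)"
        using step[of "Suc i" \<mu>] zero by simp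
      moreover have "0 \<le> \<beta>' (Suc i) * ?P (Suc (Suc i)) \<mu>"
        using nonneg[of "Suc (Suc i)"] Suc.prems less_imp_le[OF \<beta>'_pos]
        by (intro mult_nonneg_nonneg) auto
      moreover have "0 < \<gamma> (Suc i) * ?P i \<mu>"
        using Suc nonneg[of i] \<gamma>_pos[of "Suc i"] by (intro mult_pos_pos) force+
      ultimately show False by linarith
    qed
  qed
  have pos: "0 < ?P i \<mu>" if "i \<le> d" for i
    using no_zero[OF that] nonneg[of i] that by force
  have "j = Suc d" using j pos[of j] by (cases "j \<le> d") auto
  then have last: "?P (Suc d) \<mu> = 0" using j nonneg[of j] by force
  show ?thesis
  proof
    show "?P 0 \<mu> = 1" by simp
    show "0 < ?P i \<mu>" if "i \<le> d" for i using pos that .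
    show "\<gamma> i * ?P (i - 1) \<mu> + \<alpha> i * ?P i \<mu> + \<beta> i * ?P (Suc i) \<mu> = \<mu> * ?P i \<mu>" if "i \<le> d" for i
    proof (cases "i = d")
      case True
      then show ?thesis using step[of i \<mu>] \<beta>_d last by (simp add: algebra_simps del: sturm.simps)
    next
      case False
      then show ?thesis using step[of i \<mu>] that
        by (simp add: \<beta>'_def algebra_simps del: sturm.simps)
    qed
  qed
qed

section \<open>Connectedness\<close>

text \<open>
  Connectedness as an induction principle, for the spheres and the distance graphs alike.
\<close>
definition linked :: "'a set \<Rightarrow> ('a \<Rightarrow> 'a \<Rightarrow> bool) \<Rightarrow> bool" where
  "linked S R \<longleftrightarrow> (\<forall>T\<subseteq>S. T \<noteq> {} \<longrightarrow> (\<forall>x\<in>T. \<forall>y\<in>S. R x y \<longrightarrow> y \<in> T) \<longrightarrow> T = S)"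

lemma linked_induct:
  assumes "linked S R" "x \<in> S" "P x" "\<And>x y. x \<in> S \<Longrightarrow> y \<in> S \<Longrightarrow> P x \<Longrightarrow> R x y \<Longrightarrow> P y" "y \<in> S"
  shows "P y"
proof -
  have "{x \<in> S. P x} = S"
    using assms(1)[unfolded linked_def, rule_format, of "{x \<in> S. P x}"] assms(2-4) by blast
  then show ?thesis using assms(5) by blast
qed

lemma linked_verts:
  assumes "Digraph_Component.connected G"
    and "\<And>u v. (u, v) \<in> arcs_ends G \<Longrightarrow> R u v \<and> R v u"
  shows "linked (verts G) R"
  unfolding linked_def
proof (intro allI impI)
  fix T assume T: "T \<subseteq> verts G" "T \<noteq> {}" "\<forall>x\<in>T. \<forall>y\<in>verts G. R x y \<longrightarrow> y \<in> T"
  obtain x where x: "x \<in> T" using T(2) by blast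
  have "y \<in> T" if "y \<in> verts G" for y
  proof -
    have "x \<rightarrow>\<^sup>*\<^bsub>with_proj (mk_symmetric G)\<^esub> y"
      using assms(1) that x T(1)
      by (auto simp: Digraph_Component.connected_def strongly_connected_def)
    then show ?thesis
      unfolding reachable_def
    proof (induction rule: rtrancl_on_induct)
      case base
      then show ?case using x by simp
    next
      case (step y z)
      then have "(y, z) \<in> arcs_ends G \<or> (z, y) \<in> arcs_ends G"
        by (auto simp: parcs_mk_symmetric arcs_ends_conv)
      then show ?case using step assms(2) T(3) by auto
    qed
  qed
  then show "T = verts G" using T(1) by blast
qed

section \<open>Intersection numbers and kernels depending on the distance\<close>

text \<open>
  Distance-regular graphs of diameter \<open>d\<close>, seen as finite integral metric spaces: \<open>N\<close> gives the neighbours,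
  and \<open>D_predecessor\<close> makes \<open>D\<close> the path metric.
\<close>
locale distance_regular_space =
  fixes V :: "'a set" and N :: "'a \<Rightarrow> 'a set" and D :: "'a \<Rightarrow> 'a \<Rightarrow> nat"
    and b c :: "nat \<Rightarrow> nat" and d :: nat
  assumes finite_V: "finite V"
    and N_subset: "v \<in> V \<Longrightarrow> N v \<subseteq> V"
    and D_eq_0_iff: "u \<in> V \<Longrightarrow> v \<in> V \<Longrightarrow> D u v = 0 \<longleftrightarrow> u = v"
    and D_commute: "u \<in> V \<Longrightarrow> v \<in> V \<Longrightarrow> D u v = D v u"
    and D_triangle: "u \<in> V \<Longrightarrow> v \<in> V \<Longrightarrow> w \<in> V \<Longrightarrow> D u w \<le> D u v + D v w"
    and D_eq_1_iff: "u \<in> V \<Longrightarrow> v \<in> V \<Longrightarrow> D u v = 1 \<longleftrightarrow> v \<in> N u"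
    and D_predecessor: "u \<in> V \<Longrightarrow> v \<in> V \<Longrightarrow> D u v = Suc i \<Longrightarrow> \<exists>w\<in>N v. D u w = i"
    and card_closer: "u \<in> V \<Longrightarrow> v \<in> V \<Longrightarrow> card {w \<in> N v. D u w + 1 = D u v} = c (D u v)"
    and card_farther: "u \<in> V \<Longrightarrow> v \<in> V \<Longrightarrow> card {w \<in> N v. D u w = D u v + 1} = b (D u v)"
    and D_le: "u \<in> V \<Longrightarrow> v \<in> V \<Longrightarrow> D u v \<le> d"
    and D_attained: "\<exists>u\<in>V. \<exists>v\<in>V. D u v = d"
begin

text \<open>
  The intersection number \<open>a\<^sub>i\<close>, as a real number because natural subtraction truncates.
\<close>
definition a :: "nat \<Rightarrow> real" where
  "a i = real (b 0) - real (c i) - real (b i)"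

lemma in_N_iff: "v \<in> V \<Longrightarrow> w \<in> N v \<longleftrightarrow> w \<in> V \<and> D v w = 1"
  using N_subset D_eq_1_iff by blast

lemma N_sym: "v \<in> V \<Longrightarrow> w \<in> V \<Longrightarrow> w \<in> N v \<longleftrightarrow> v \<in> N w"
  by (simp add: in_N_iff D_commute[of v w])

lemma finite_N: "v \<in> V \<Longrightarrow> finite (N v)"
  using N_subset finite_V finite_subset by blast

lemma D_self: "v \<in> V \<Longrightarrow> D v v = 0"
  by (simp add: D_eq_0_iff)

lemma D_neighbour:
  assumes "u \<in> V" "v \<in> V" "w \<in> N v"
  shows "D u w \<le> D u v + 1" "D u v \<le> D u w + 1"
proof -
  have w: "w \<in> V" "D v w = 1" "D w v = 1"
    using assms in_N_iff D_commute by auto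
  show "D u w \<le> D u v + 1" using D_triangle[of u v w] assms w by simp
  show "D u v \<le> D u w + 1" using D_triangle[of u w v] assms w by simp
qed

lemma card_N: "v \<in> V \<Longrightarrow> card (N v) = b 0"
proof -
  assume v: "v \<in> V"
  then have "{w \<in> N v. D v w = D v v + 1} = N v"
    using in_N_iff D_self by auto
  then show ?thesis using card_farther[OF v v] v by (simp add: D_self)
qed

lemma geodesic_vertex:
  assumes "u \<in> V" "v \<in> V" "i \<le> D u v"
  shows "\<exists>w\<in>V. D u w = i \<and> D w v = D u v - i"
  using assms(3)
proof (induction "D u v - i" arbitrary: i)
  case 0
  then show ?case using assms by (intro bexI[of _ v]) (auto simp: D_self)
next
  case (Suc n)
  then obtain w where w: "w \<in> V" "D u w = Suc i" "D w v = D u v - Suc i"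
    using Suc.hyps(1)[of "Suc i"] Suc.hyps(2) by fastforce
  then obtain x where x: "x \<in> N w" "D u x = i" using D_predecessor assms by blast
  have xV: "x \<in> V" using x w N_subset by blast
  have "D v x \<le> D v w + 1" using D_neighbour(1)[OF assms(2) w(1) x(1)] .
  moreover have "D u v \<le> D u x + D x v" using D_triangle assms xV by blast
  ultimately have "D x v = D u v - i"
    using w x Suc D_commute assms xV by auto
  then show ?case using x xV by blast
qed

lemma c_0: "c 0 = 0"
  using D_attained card_closer[of _ _] D_self by (metis (mono_tags, lifting) Collect_empty_eq
      Suc_eq_plus1 card.empty nat.simps(3))

lemma c_pos:
  assumes "1 \<le> i" "i \<le> d"
  shows "0 < c i"
proof -
  obtain u v where uv: "u \<in> V" "v \<in> V" "D u v = d" using D_attained by blast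
  then obtain w where w: "w \<in> V" "D u w = i" using geodesic_vertex[of u v i] assms by auto
  then obtain x where "x \<in> N w" "D u x = i - 1"
    using D_predecessor[of u w "i - 1"] uv assms by auto
  then have "{x \<in> N w. D u x + 1 = D u w} \<noteq> {}" using w assms by auto
  then have "0 < card {x \<in> N w. D u x + 1 = D u w}"
    using finite_N[OF w(1)] by (simp add: card_gt_0_iff)
  then show ?thesis using card_closer[of u w] w uv by simp
qed

lemma b_pos:
  assumes "i < d"
  shows "0 < b i"
proof -
  obtain u v where uv: "u \<in> V" "v \<in> V" "D u v = d" using D_attained by blast
  then obtain w where w: "w \<in> V" "D u w = Suc i" using geodesic_vertex[of u v "Suc i"] assms by auto
  then obtain x where x: "x \<in> N w" "D u x = i"
    using D_predecessor[of u w i] uv by auto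
  then have xV: "x \<in> V" using w N_subset by blast
  then have "w \<in> {y \<in> N x. D u y = D u x + 1}" using w x N_sym by auto
  then have "0 < card {y \<in> N x. D u y = D u x + 1}"
    using finite_N[OF xV] by (auto simp: card_gt_0_iff)
  then show ?thesis using card_farther[of u x] x xV uv by simp
qed

lemma b_d: "b d = 0"
proof -
  obtain u v where uv: "u \<in> V" "v \<in> V" "D u v = d" using D_attained by blast
  have empty: "{w \<in> N v. D u w = D u v + 1} = {}"
    using uv D_le[of u] N_subset by fastforce
  show ?thesis using card_farther[of u v] uv unfolding empty by simp
qed

text \<open>
  As \<open>b\<^sub>i > 0\<close> for \<open>i < d\<close>, a geodesic from \<open>u\<close> to \<open>v\<close> can be continued step by step until it has
  length \<open>d\<close>.
\<close>
lemma antipode_extension: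
  assumes "u \<in> V" "v \<in> V"
  shows "\<exists>w\<in>V. D u w = d \<and> D v w = d - D u v"
proof -
  have "\<exists>w\<in>V. D u w = D u v + j \<and> D v w = j" if "D u v + j \<le> d" for j
    using that
  proof (induction j)
    case 0
    then show ?case using assms by (intro bexI[of _ v]) (auto simp: D_self)
  next
    case (Suc j)
    then obtain w where w: "w \<in> V" "D u w = D u v + j" "D v w = j" by auto
    have "0 < card {x \<in> N w. D u x = D u w + 1}"
      using card_farther[of u w] b_pos[of "D u w"] w assms Suc by simp
    then obtain x where x: "x \<in> N w" "D u x = D u w + 1"
      by (auto simp: card_gt_0_iff)
    then have xV: "x \<in> V" using w N_subset by blast
    have "D v x \<le> Suc j" using D_neighbour(1)[OF assms(2) w(1) x(1)] w by simp
    moreover have "D u x \<le> D u v + D v x" using D_triangle assms xV by blast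
    ultimately show ?case using w x xV by (intro bexI[of _ x]) auto
  qed
  from this[of "d - D u v"] show ?thesis using D_le[OF assms] by auto
qed

text \<open>
  On functions of the distance from \<open>v\<close> the adjacency matrix acts as the tridiagonal matrix of the
  intersection numbers.
\<close>
lemma sum_neighbours_radial:
  fixes h :: "nat \<Rightarrow> real"
  assumes "u \<in> V" "v \<in> V"
  shows "(\<Sum>w\<in>N u. h (D v w)) =
    c (D v u) * h (D v u - 1) + a (D v u) * h (D v u) + b (D v u) * h (D v u + 1)"
proof -
  let ?i = "D v u"
  let ?A = "{w \<in> N u. D v w + 1 = ?i}" and ?B = "{w \<in> N u. D v w = ?i + 1}"
    and ?C = "{w \<in> N u. D v w = ?i}"
  have fin: "finite (N u)" using finite_N assms by blast
  have split: "N u = (?A \<union> ?B) \<union> ?C" using D_neighbour[OF assms(2,1)] by force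
  have cA: "card ?A = c ?i" using card_closer assms by blast
  have cB: "card ?B = b ?i" using card_farther assms by blast
  have "card ((?A \<union> ?B) \<union> ?C) = card (?A \<union> ?B) + card ?C"
    by (rule card_Un_disjoint) (use fin in auto)
  also have "card (?A \<union> ?B) = card ?A + card ?B"
    by (rule card_Un_disjoint) (use fin in auto)
  finally have cC: "real (card ?C) = a ?i"
    using card_N[OF assms(1)] cA cB split unfolding a_def by simp
  have "(\<Sum>w\<in>N u. h (D v w)) = (\<Sum>w\<in>?A \<union> ?B. h (D v w)) + (\<Sum>w\<in>?C. h (D v w))"
    by (subst (1) split, rule sum.union_disjoint) (use fin in auto)
  also have "(\<Sum>w\<in>?A \<union> ?B. h (D v w)) = (\<Sum>w\<in>?A. h (D v w)) + (\<Sum>w\<in>?B. h (D v w))"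
    by (rule sum.union_disjoint) (use fin in auto)
  also have "(\<Sum>w\<in>?A. h (D v w)) = (\<Sum>w\<in>?A. h (?i - 1))"
    by (rule sum.cong) (auto intro!: arg_cong[where f = h])
  also have "(\<Sum>w\<in>?B. h (D v w)) = (\<Sum>w\<in>?B. h (?i + 1))"
    by (rule sum.cong) auto
  also have "(\<Sum>w\<in>?C. h (D v w)) = (\<Sum>w\<in>?C. h ?i)"
    by (rule sum.cong) auto
  finally show ?thesis using cA cB cC by simp
qed

lemma sum_adjacent_swap:
  fixes F :: "'a \<Rightarrow> 'a \<Rightarrow> real"
  shows "(\<Sum>u\<in>V. \<Sum>w\<in>N u. F u w) = (\<Sum>u\<in>V. \<Sum>w\<in>N u. F w u)"
proof -
  have *: "(\<Sum>w\<in>N u. G w) = (\<Sum>w\<in>V. of_bool (w \<in> N u) * G w)" if "u \<in> V" for u and G :: "'a \<Rightarrow> real"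
    using N_subset[OF that] finite_V
    by (intro sum.mono_neutral_cong_left) auto
  have "(\<Sum>u\<in>V. \<Sum>w\<in>N u. F u w) = (\<Sum>u\<in>V. \<Sum>w\<in>V. of_bool (w \<in> N u) * F u w)"
    by (rule sum.cong) (auto simp: *)
  also have "\<dots> = (\<Sum>w\<in>V. \<Sum>u\<in>V. of_bool (w \<in> N u) * F u w)"
    by (rule sum.swap)
  also have "\<dots> = (\<Sum>w\<in>V. \<Sum>u\<in>V. of_bool (u \<in> N w) * F u w)"
    by (intro sum.cong refl) (use N_sym in auto)
  also have "\<dots> = (\<Sum>w\<in>V. \<Sum>u\<in>N w. F u w)"
    by (rule sum.cong) (auto simp: *)
  finally show ?thesis .
qed

text \<open>
  The radial kernels are the elements of the Bose-Mesner algebra; that they form an algebra is what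
  makes the sum over \<open>x\<close> in the main argument depend on the image of an edge only through its being an
  edge.
\<close>
definition radial :: "('a \<Rightarrow> 'a \<Rightarrow> real) \<Rightarrow> bool" where
  "radial K \<longleftrightarrow> (\<exists>\<kappa>. \<forall>u\<in>V. \<forall>v\<in>V. K u v = \<kappa> (D u v))"

lemma radial_adjacency:
  assumes "radial K"
  shows "radial (\<lambda>u v. \<Sum>w\<in>N u. K w v)"
proof -
  obtain \<kappa> where \<kappa>: "\<And>u v. u \<in> V \<Longrightarrow> v \<in> V \<Longrightarrow> K u v = \<kappa> (D u v)"
    using assms unfolding radial_def by blast
  have "(\<Sum>w\<in>N u. K w v) = c (D u v) * \<kappa> (D u v - 1) + a (D u v) * \<kappa> (D u v) + b (D u v) * \<kappa> (D u v + 1)"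
    if "u \<in> V" "v \<in> V" for u v
  proof -
    have "(\<Sum>w\<in>N u. K w v) = (\<Sum>w\<in>N u. \<kappa> (D v w))"
      using \<kappa> that N_subset D_commute by (intro sum.cong) (auto simp: subset_iff)
    then show ?thesis using sum_neighbours_radial[OF that] D_commute[OF that] by simp
  qed
  then show ?thesis unfolding radial_def
    by (intro exI[of _ "\<lambda>i. c i * \<kappa> (i - 1) + a i * \<kappa> i + b i * \<kappa> (i + 1)"]) simp
qed

lemma radial_diff:
  assumes "radial K" "radial L"
  shows "radial (\<lambda>u v. K u v - L u v)"
proof -
  obtain \<kappa> \<kappa>' where "\<forall>u\<in>V. \<forall>v\<in>V. K u v = \<kappa> (D u v)" "\<forall>u\<in>V. \<forall>v\<in>V. L u v = \<kappa>' (D u v)"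
    using assms unfolding radial_def by blast
  then show ?thesis unfolding radial_def by (intro exI[of _ "\<lambda>i. \<kappa> i - \<kappa>' i"]) simp
qed

lemma radial_scale:
  assumes "radial K"
  shows "radial (\<lambda>u v. r * K u v)"
proof -
  obtain \<kappa> where "\<forall>u\<in>V. \<forall>v\<in>V. K u v = \<kappa> (D u v)"
    using assms unfolding radial_def by blast
  then show ?thesis unfolding radial_def by (intro exI[of _ "\<lambda>i. r * \<kappa> i"]) simp
qed

lemma radial_cong: "(\<And>u v. u \<in> V \<Longrightarrow> v \<in> V \<Longrightarrow> K u v = L u v) \<Longrightarrow> radial K \<longleftrightarrow> radial L"
  unfolding radial_def by simp

lemma sum_neighbours_sphere:
  assumes "u \<in> V" "v \<in> V"
  shows "(\<Sum>w\<in>N u. of_bool (D w v = i) :: real) =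
    c (Suc i) * of_bool (D u v = Suc i) + a i * of_bool (D u v = i)
      + (if i = 0 then 0 else b (i - 1) * of_bool (D u v = i - 1))"
proof -
  have "(\<Sum>w\<in>N u. of_bool (D w v = i) :: real) = (\<Sum>w\<in>N u. of_bool (D v w = i))"
    using assms N_subset D_commute by (intro sum.cong) (auto simp: subset_iff)
  also have "\<dots> = real (c (D u v)) * of_bool (D u v - 1 = i) + a (D u v) * of_bool (D u v = i)
      + real (b (D u v)) * of_bool (D u v + 1 = i)"
    using sum_neighbours_radial[OF assms, of "\<lambda>j. of_bool (j = i)"] D_commute[OF assms] by simp
  also have "\<dots> = c (Suc i) * of_bool (D u v = Suc i) + a i * of_bool (D u v = i)
      + (if i = 0 then 0 else b (i - 1) * of_bool (D u v = i - 1))"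
    using c_0 by (cases "D u v"; cases i) (auto simp: of_bool_def)
  finally show ?thesis .
qed

text \<open>
  Let \<open>A\<^sub>i\<close> be the adjacency matrix of the relation of being at distance \<open>i\<close>. The recurrence
  \<open>A A\<^sub>j = c\<^sub>j\<^sub>+\<^sub>1 A\<^sub>j\<^sub>+\<^sub>1 + a\<^sub>j A\<^sub>j + b\<^sub>j\<^sub>-\<^sub>1 A\<^sub>j\<^sub>-\<^sub>1\<close> with \<open>c\<^sub>j\<^sub>+\<^sub>1 \<noteq> 0\<close> reduces the product of \<open>A\<^sub>j\<^sub>+\<^sub>1\<close> and a
  radial kernel to products with \<open>A\<close>, \<open>A\<^sub>j\<close> and \<open>A\<^sub>j\<^sub>-\<^sub>1\<close>.
\<close>
lemma radial_sphere_sum: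
  assumes "radial K" "i \<le> d"
  shows "radial (\<lambda>u v. \<Sum>x\<in>V. of_bool (D u x = i) * K x v)"
  using assms(2)
proof (induction i rule: less_induct)
  case (less i)
  let ?S = "\<lambda>i u v. \<Sum>x\<in>V. of_bool (D u x = i) * K x v"
  show ?case
  proof (cases i)
    case 0
    have "?S 0 u v = K u v" if "u \<in> V" "v \<in> V" for u v
    proof -
      have "?S 0 u v = (\<Sum>x\<in>V. if x = u then K x v else 0)"
        using that by (intro sum.cong) (auto simp: D_eq_0_iff)
      then show ?thesis using that finite_V by simp
    qed
    then show ?thesis using assms(1) 0 by (subst radial_cong[of _ K]) auto
  next
    case (Suc j)
    let ?L = "\<lambda>u v. (1 / c (Suc j)) * ((\<Sum>w\<in>N u. ?S j w v) - a j * ?S j u v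
      - (if j = 0 then 0 else b (j - 1)) * ?S (j - 1) u v)"
    have "?S (Suc j) u v = ?L u v" if "u \<in> V" "v \<in> V" for u v
    proof -
      have "(\<Sum>w\<in>N u. ?S j w v) = (\<Sum>x\<in>V. (\<Sum>w\<in>N u. of_bool (D w x = j)) * K x v)"
        by (subst sum.swap) (simp add: sum_distrib_right)
      also have "\<dots> = (\<Sum>x\<in>V. c (Suc j) * (of_bool (D u x = Suc j) * K x v)
          + a j * (of_bool (D u x = j) * K x v)
          + (if j = 0 then 0 else b (j - 1)) * (of_bool (D u x = j - 1) * K x v))"
        by (intro sum.cong refl, subst sum_neighbours_sphere) (use that in \<open>auto simp: algebra_simps\<close>)
      also have "\<dots> = c (Suc j) * ?S (Suc j) u v + a j * ?S j u v
          + (if j = 0 then 0 else b (j - 1)) * ?S (j - 1) u v"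
        by (simp only: sum.distrib sum_distrib_left)
      finally show ?thesis using c_pos[of "Suc j"] less.prems Suc by (simp add: field_simps)
    qed
    moreover have "radial (?S j)" "radial (?S (j - 1))"
      using less.IH[of j] less.IH[of "j - 1"] less.prems Suc by simp_all
    then have "radial ?L"
      by (intro radial_scale radial_diff radial_adjacency)
    ultimately show ?thesis using Suc radial_cong[of "?S (Suc j)" ?L] by simp
  qed
qed

lemma radial_sum:
  assumes "finite I" "\<And>i. i \<in> I \<Longrightarrow> radial (K i)"
  shows "radial (\<lambda>u v. \<Sum>i\<in>I. K i u v)"
proof -
  obtain \<kappa> where "\<And>i u v. i \<in> I \<Longrightarrow> u \<in> V \<Longrightarrow> v \<in> V \<Longrightarrow> K i u v = \<kappa> i (D u v)"
    using assms(2) unfolding radial_def by metis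
  then show ?thesis unfolding radial_def by (intro exI[of _ "\<lambda>j. \<Sum>i\<in>I. \<kappa> i j"]) simp
qed

lemma radial_product:
  fixes g :: "nat \<Rightarrow> real"
  assumes "radial K"
  shows "radial (\<lambda>u v. \<Sum>x\<in>V. g (D u x) * K x v)"
proof -
  let ?S = "\<lambda>i u v. \<Sum>x\<in>V. of_bool (D u x = i) * K x v"
  have "(\<Sum>x\<in>V. g (D u x) * K x v) = (\<Sum>i\<le>d. g i * ?S i u v)" if "u \<in> V" for u v
  proof -
    have "g (D u x) * K x v = (\<Sum>i\<le>d. g i * (of_bool (D u x = i) * K x v))" if "x \<in> V" for x
    proof -
      have "(\<Sum>i\<le>d. g i * (of_bool (D u x = i) * K x v)) = (\<Sum>i\<le>d. if i = D u x then g i * K x v else 0)"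
        by (intro sum.cong) auto
      then show ?thesis using D_le[OF \<open>u \<in> V\<close> that] by simp
    qed
    then have "(\<Sum>x\<in>V. g (D u x) * K x v) = (\<Sum>x\<in>V. \<Sum>i\<le>d. g i * (of_bool (D u x = i) * K x v))"
      by (intro sum.cong) auto
    then show ?thesis by (subst (asm) sum.swap) (simp add: sum_distrib_left)
  qed
  moreover have "radial (\<lambda>u v. \<Sum>i\<le>d. g i * ?S i u v)"
    by (rule radial_sum) (use radial_sphere_sum[OF assms] in \<open>auto intro: radial_scale\<close>)
  ultimately show ?thesis by (subst radial_cong) auto
qed

section \<open>The least eigenvalue\<close>

text \<open>
  With \<open>b 0 - A\<close> in place of \<open>A\<close>, the least eigenvalue of \<open>A\<close> becomes the largest eigenvalue \<open>\<mu>\<close> of the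
  Laplacian, and the alternating vector becomes the positive vector \<open>G\<close>.
\<close>
definition laplacian :: "('a \<Rightarrow> real) \<Rightarrow> 'a \<Rightarrow> real" where
  "laplacian f u = real (b 0) * f u - (\<Sum>w\<in>N u. f w)"

definition ip :: "('a \<Rightarrow> real) \<Rightarrow> ('a \<Rightarrow> real) \<Rightarrow> real" where
  "ip f h = (\<Sum>u\<in>V. f u * h u)"

lemma ip_commute: "ip f h = ip h f"
  by (simp add: ip_def mult.commute)

lemma ip_self_nonneg: "0 \<le> ip f f"
  by (simp add: ip_def sum_nonneg)

lemma ip_self_eq_0_iff: "ip f f = 0 \<longleftrightarrow> (\<forall>u\<in>V. f u = 0)"
  by (simp add: ip_def finite_V sum_nonneg_eq_0_iff)

lemma Cauchy_Schwarz_ip: "(ip f h)\<^sup>2 \<le> ip f f * ip h h"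
  using Cauchy_Schwarz_ineq_sum[of f h V] by (simp add: ip_def power2_eq_square)

lemma ip_laplacian_swap: "ip (laplacian f) h = ip f (laplacian h)"
proof -
  have "(\<Sum>u\<in>V. \<Sum>w\<in>N u. f w * h u) = (\<Sum>u\<in>V. \<Sum>w\<in>N u. f u * h w)"
    by (rule sum_adjacent_swap)
  then show ?thesis
    by (simp add: ip_def laplacian_def algebra_simps sum_subtractf sum_distrib_left)
qed

lemma ip_funpow_swap: "ip ((laplacian ^^ m) f) h = ip f ((laplacian ^^ m) h)"
  by (induction m arbitrary: f h) (simp_all add: ip_laplacian_swap funpow_swap1)

context
  fixes \<mu> :: real and G :: "nat \<Rightarrow> real"
  assumes G_0: "G 0 = 1" and G_pos: "\<And>i. i \<le> d \<Longrightarrow> 0 < G i"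
    and G_eigen: "\<And>i. i \<le> d \<Longrightarrow>
      c i * G (i - 1) + (b 0 - a i) * G i + b i * G (Suc i) = \<mu> * G i"
begin

lemma eigenvalue_nonneg: "0 \<le> \<mu>"
proof -
  have "0 \<le> b 0 * G (Suc 0)" using G_pos[of 1] b_d by (cases "d = 0") auto
  then show ?thesis using G_eigen[of 0] G_0 c_0 by (simp add: a_def)
qed

text \<open>
  Conjugated by the alternating signs, the Laplacian acts on radial functions by a matrix with
  nonnegative entries, of which \<open>G\<close> is a positive eigenvector. So a bound by a multiple of \<open>G\<close> is passed on with a
  factor \<open>\<mu>\<close>, and a point mass is bounded by \<open>G\<close> because \<open>G 0 = 1\<close>.
\<close>
lemma powers_at_vertex_bound:
  assumes "v \<in> V"
  shows "\<exists>h. (\<forall>u\<in>V. (laplacian ^^ m) (\<lambda>w. of_bool (w = v)) u = h (D v u)) \<and> (\<forall>i\<le>d. \<bar>h i\<bar> \<le> \<mu> ^ m * G i)"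
proof (induction m)
  case 0
  have "\<bar>of_bool (i = 0)\<bar> \<le> G i" if "i \<le> d" for i
    using G_0 G_pos[OF that] by (cases i) auto
  then show ?case
    using D_eq_0_iff[OF assms] by (intro exI[of _ "\<lambda>i. of_bool (i = 0)"]) auto
next
  case (Suc m)
  then obtain h where h: "\<And>u. u \<in> V \<Longrightarrow> (laplacian ^^ m) (\<lambda>w. of_bool (w = v)) u = h (D v u)"
    and bound: "\<And>i. i \<le> d \<Longrightarrow> \<bar>h i\<bar> \<le> \<mu> ^ m * G i" by blast
  define h' where "h' i = (b 0 - a i) * h i - c i * h (i - 1) - b i * h (Suc i)" for i
  have "(laplacian ^^ Suc m) (\<lambda>w. of_bool (w = v)) u = h' (D v u)" if "u \<in> V" for u
  proof -
    have "(\<Sum>w\<in>N u. (laplacian ^^ m) (\<lambda>w. of_bool (w = v)) w) = (\<Sum>w\<in>N u. h (D v w))"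
      using h N_subset[OF that] by (intro sum.cong) auto
    then show ?thesis
      using sum_neighbours_radial[OF that assms, of h] h[OF that]
      by (simp add: laplacian_def h'_def algebra_simps)
  qed
  moreover have "\<bar>h' i\<bar> \<le> \<mu> ^ Suc m * G i" if "i \<le> d" for i
  proof -
    have coeff: "0 \<le> b 0 - a i" by (simp add: a_def)
    have top: "b i * \<bar>h (Suc i)\<bar> \<le> b i * (\<mu> ^ m * G (Suc i))"
      using bound[of "Suc i"] that b_d by (cases "i = d") (auto intro!: mult_left_mono)
    have "\<bar>h' i\<bar> \<le> (b 0 - a i) * \<bar>h i\<bar> + c i * \<bar>h (i - 1)\<bar> + b i * \<bar>h (Suc i)\<bar>"
      unfolding h'_def using coeff
      by (intro order_trans[OF abs_triangle_ineq4] add_mono) (simp_all add: abs_mult)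
    also have "\<dots> \<le> (b 0 - a i) * (\<mu> ^ m * G i) + c i * (\<mu> ^ m * G (i - 1)) + b i * (\<mu> ^ m * G (Suc i))"
      using coeff bound that by (intro add_mono[OF add_mono top] mult_left_mono) auto
    also have "\<dots> = \<mu> ^ m * (c i * G (i - 1) + (b 0 - a i) * G i + b i * G (Suc i))"
      by (simp add: algebra_simps)
    also have "\<dots> = \<mu> ^ Suc m * G i"
      by (simp only: G_eigen[OF that]) simp
    finally show ?thesis .
  qed
  ultimately show ?case by blast
qed

lemma power_form_bound: "\<exists>K. \<forall>m. ip f ((laplacian ^^ m) f) \<le> K * \<mu> ^ m"
proof -
  define K where "K = (\<Sum>u\<in>V. \<bar>f u\<bar> * (\<Sum>w\<in>V. G (D u w) * \<bar>f w\<bar>))"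
  have "ip f ((laplacian ^^ m) f) \<le> K * \<mu> ^ m" for m
  proof -
    have "f u * (laplacian ^^ m) f u \<le> \<bar>f u\<bar> * (\<Sum>w\<in>V. G (D u w) * \<bar>f w\<bar>) * \<mu> ^ m" if u: "u \<in> V" for u
    proof -
      obtain h where h: "\<And>w. w \<in> V \<Longrightarrow> (laplacian ^^ m) (\<lambda>w. of_bool (w = u)) w = h (D u w)"
        and bound: "\<And>i. i \<le> d \<Longrightarrow> \<bar>h i\<bar> \<le> \<mu> ^ m * G i"
        using powers_at_vertex_bound[OF u] by blast
      have "(laplacian ^^ m) f u = ip (\<lambda>w. of_bool (w = u)) ((laplacian ^^ m) f)"
        using u finite_V by (simp add: ip_def of_bool_def if_distrib[of "\<lambda>x. x * _"] cong: if_cong)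
      also have "\<dots> = (\<Sum>w\<in>V. h (D u w) * f w)"
        using h by (subst ip_funpow_swap[symmetric]) (simp add: ip_def)
      finally have "\<bar>(laplacian ^^ m) f u\<bar> \<le> (\<Sum>w\<in>V. \<bar>h (D u w) * f w\<bar>)" by simp
      also have "\<dots> \<le> (\<Sum>w\<in>V. \<mu> ^ m * G (D u w) * \<bar>f w\<bar>)"
        using bound D_le[OF u] by (intro sum_mono) (auto simp: abs_mult intro!: mult_right_mono)
      finally have "\<bar>f u\<bar> * \<bar>(laplacian ^^ m) f u\<bar> \<le> \<bar>f u\<bar> * (\<Sum>w\<in>V. \<mu> ^ m * G (D u w) * \<bar>f w\<bar>)"
        by (rule mult_left_mono) simp
      moreover have "f u * (laplacian ^^ m) f u \<le> \<bar>f u\<bar> * \<bar>(laplacian ^^ m) f u\<bar>"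
        by (simp flip: abs_mult)
      ultimately show ?thesis by (simp add: sum_distrib_left sum_distrib_right mult_ac)
    qed
    then have "ip f ((laplacian ^^ m) f) \<le> (\<Sum>u\<in>V. \<bar>f u\<bar> * (\<Sum>w\<in>V. G (D u w) * \<bar>f w\<bar>) * \<mu> ^ m)"
      unfolding ip_def by (intro sum_mono) auto
    then show ?thesis by (simp add: K_def sum_distrib_right)
  qed
  then show ?thesis by blast
qed

text \<open>
  Doubling the exponent costs one application of the Cauchy-Schwarz inequality.
\<close>
lemma power_form_growth:
  assumes "0 < ip f f" "0 \<le> ip f (laplacian f)"
  shows "(ip f (laplacian f) / ip f f) ^ (2 ^ j) * ip f f \<le> ip f ((laplacian ^^ (2 ^ j)) f)"
proof (induction j)
  case 0
  then show ?case using assms by simp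
next
  case (Suc j)
  let ?r = "ip f (laplacian f) / ip f f" and ?n = "(2::nat) ^ j"
  have "(?r ^ ?n * ip f f)\<^sup>2 \<le> (ip f ((laplacian ^^ ?n) f))\<^sup>2"
    using Suc assms by (intro power_mono) auto
  also have "\<dots> \<le> ip f f * ip ((laplacian ^^ ?n) f) ((laplacian ^^ ?n) f)" by (rule Cauchy_Schwarz_ip)
  also have "ip ((laplacian ^^ ?n) f) ((laplacian ^^ ?n) f) = ip f ((laplacian ^^ (2 ^ Suc j)) f)"
    by (simp add: ip_funpow_swap mult_2 funpow_add)
  finally have "ip f f * (?r ^ (2 ^ Suc j) * ip f f) \<le> ip f f * ip f ((laplacian ^^ (2 ^ Suc j)) f)"
    by (simp add: power2_eq_square power_add mult_2 mult_ac)
  then show ?case using assms(1) by (simp only: mult_le_cancel_left_pos)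
qed

text \<open>
  If the Rayleigh quotient \<open>r\<close> of \<open>f\<close> exceeded \<open>\<mu>\<close>, the quadratic form of the powers would grow at least like
  \<open>r ^ m\<close> along the powers of two, against the bound by a multiple of \<open>\<mu> ^ m\<close>.
\<close>
lemma rayleigh_bound: "ip f (laplacian f) \<le> \<mu> * ip f f"
proof (rule ccontr)
  assume neg: "\<not> ?thesis"
  have s0: "0 < ip f f"
  proof (rule ccontr)
    assume "\<not> 0 < ip f f"
    then have zero: "ip f f = 0" using ip_self_nonneg[of f] by linarith
    then have "\<forall>u\<in>V. f u = 0" by (simp only: ip_self_eq_0_iff)
    then have "ip f (laplacian f) = 0" by (simp add: ip_def)
    then show False using neg zero by simp
  qed
  define r where "r = ip f (laplacian f) / ip f f"
  have r: "\<mu> < r" using neg s0 by (simp add: r_def field_simps)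
  have s1: "0 \<le> ip f (laplacian f)" using neg eigenvalue_nonneg s0 by (smt (verit) mult_nonneg_nonneg)
  obtain K where K: "\<And>m. ip f ((laplacian ^^ m) f) \<le> K * \<mu> ^ m" using power_form_bound by blast
  have main: "r ^ (2 ^ j) * ip f f \<le> K * \<mu> ^ (2 ^ j)" for j
    using power_form_growth[OF s0 s1, of j] K[of "2 ^ j"] unfolding r_def by linarith
  have rpos: "0 < r" using r eigenvalue_nonneg by linarith
  have \<mu>pos: "0 < \<mu>"
  proof (rule ccontr)
    assume "\<not> 0 < \<mu>"
    then have "\<mu> = 0" using eigenvalue_nonneg by linarith
    then show False using main[of 0] rpos s0 by (simp add: mult_le_0_iff)
  qed
  define q where "q = r / \<mu>"
  have q: "1 < q" using r \<mu>pos by (simp add: q_def)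
  obtain n where n: "K / ip f f < q ^ n" using real_arch_pow[OF q] by blast
  have "q ^ n \<le> q ^ (2 ^ n)"
    using q by (intro power_increasing) (auto simp: less_imp_le less_exp)
  also have "q ^ (2 ^ n) \<le> K / ip f f"
    using main[of n] s0 \<mu>pos by (simp add: q_def power_divide field_simps)
  finally show False using n by simp
qed

text \<open>
  The form \<open>\<mu> \<langle>h, h\<rangle> - \<langle>h, laplacian h\<rangle>\<close> is nonnegative and vanishes at \<open>f\<close>, so its gradient \<open>2 e\<close> at \<open>f\<close>
  vanishes too: otherwise a short step \<open>s\<close> against \<open>e\<close> would make the form negative.
\<close>
lemma rayleigh_equality:
  assumes "ip f (laplacian f) = \<mu> * ip f f" "u \<in> V"
  shows "laplacian f u = \<mu> * f u"
proof -
  define e where "e w = \<mu> * f w - laplacian f w" for w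
  define E where "E = ip e e"
  define s where "s = E / (\<mu> * E - ip e (laplacian e) + 1)"
  let ?h = "\<lambda>w. f w - s * e w"
  have Qe: "0 \<le> \<mu> * E - ip e (laplacian e)" using rayleigh_bound[of e] by (simp add: E_def)
  have Lh: "laplacian ?h w = laplacian f w - s * laplacian e w" for w
    by (simp add: laplacian_def algebra_simps sum_subtractf sum_distrib_left)
  have form_Lh: "ip ?h (laplacian ?h) = ip f (laplacian f) - s * ip f (laplacian e) - s * ip e (laplacian f) + s\<^sup>2 * ip e (laplacian e)"
    by (simp add: ip_def Lh algebra_simps sum_subtractf sum.distrib sum_distrib_left power2_eq_square)
  have form_h: "ip ?h ?h = ip f f - 2 * s * ip e f + s\<^sup>2 * E"
    by (simp add: E_def ip_def algebra_simps sum_subtractf sum.distrib sum_distrib_left power2_eq_square)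
  have sym: "ip f (laplacian e) = ip e (laplacian f)" using ip_laplacian_swap[of f e] ip_commute by metis
  have "E = \<mu> * ip e f - ip e (laplacian f)"
  proof -
    have "E = (\<Sum>w\<in>V. e w * (\<mu> * f w - laplacian f w))" by (simp add: E_def ip_def e_def)
    then show ?thesis by (simp add: ip_def right_diff_distrib sum_subtractf sum_distrib_left mult_ac)
  qed
  then have "s * E = s * (\<mu> * ip e f) - s * ip e (laplacian f)" by (simp add: right_diff_distrib)
  then have "\<mu> * ip ?h ?h - ip ?h (laplacian ?h) = s\<^sup>2 * (\<mu> * E - ip e (laplacian e)) - 2 * s * E"
    unfolding form_h form_Lh sym assms(1) by (simp add: algebra_simps)
  then have ineq: "2 * s * E \<le> s\<^sup>2 * (\<mu> * E - ip e (laplacian e))"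
    using rayleigh_bound[of ?h] by linarith
  have "E = 0"
  proof (rule ccontr)
    assume "E \<noteq> 0"
    then have E: "0 < E" using ip_self_nonneg[of e] by (simp add: E_def)
    then have s: "0 < s" using Qe by (simp add: s_def)
    have "s * (2 * E) \<le> s * (s * (\<mu> * E - ip e (laplacian e)))"
      using ineq by (simp add: power2_eq_square mult_ac)
    then have "2 * E \<le> s * (\<mu> * E - ip e (laplacian e))" using s by simp
    also have "\<dots> \<le> s * (\<mu> * E - ip e (laplacian e) + 1)" using s by simp
    also have "\<dots> = E" using Qe by (simp add: s_def)
    finally show False using E by simp
  qed
  then have "e u = 0" using assms(2) by (simp add: E_def ip_self_eq_0_iff)
  then show ?thesis by (simp add: e_def)
qed

text \<open>
  The matrix \<open>M\<close> in the proof is the square of the matrix \<open>g (D y z)\<close>. Being radial, it takes one value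
  \<open>H 0\<close> on the diagonal and one value \<open>H 1\<close> on the edges, and its own eigenvector equation on the
  diagonal reads \<open>b 0 * H 1 = (b 0 - \<mu>) * H 0\<close>. A homomorphism preserves the diagonal and the edges, so
  the forms of the pulled back columns \<open>F x\<close> add up to zero, while each of them is nonnegative.
\<close>
lemma eigenvector_pullback:
  fixes g :: "nat \<Rightarrow> real"
  defines "g \<equiv> \<lambda>i. (- 1) ^ i * G i"
  assumes \<phi>_V: "\<And>u. u \<in> V \<Longrightarrow> \<phi> u \<in> V"
    and \<phi>_N: "\<And>u w. u \<in> V \<Longrightarrow> w \<in> N u \<Longrightarrow> \<phi> w \<in> N (\<phi> u)"
    and "x \<in> V" "u \<in> V"
  shows "(\<Sum>w\<in>N u. g (D (\<phi> w) x)) = (b 0 - \<mu>) * g (D (\<phi> u) x)"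
proof -
  have g_eigen: "(\<Sum>w\<in>N y. g (D w x)) = (b 0 - \<mu>) * g (D y x)" if y: "y \<in> V" and x: "x \<in> V" for x y
  proof -
    let ?i = "D y x"
    have "c ?i * g (?i - 1) = - ((- 1) ^ ?i * (c ?i * G (?i - 1)))"
      by (cases ?i) (simp_all add: g_def c_0)
    moreover have "b ?i * g (?i + 1) = - ((- 1) ^ ?i * (b ?i * G (Suc ?i)))"
      by (simp add: g_def)
    moreover have "a ?i * g ?i = (- 1) ^ ?i * (a ?i * G ?i)" by (simp add: g_def)
    moreover have "(\<Sum>w\<in>N y. g (D w x)) = (\<Sum>w\<in>N y. g (D x w))"
      using x N_subset[OF y] by (intro sum.cong) (auto simp: D_commute)
    ultimately have "(\<Sum>w\<in>N y. g (D w x)) =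
        (- 1) ^ ?i * (- (c ?i * G (?i - 1)) + a ?i * G ?i - b ?i * G (Suc ?i))"
      using sum_neighbours_radial[OF y x, of g] D_commute[OF x y] by (simp add: algebra_simps)
    also have "- (c ?i * G (?i - 1)) + a ?i * G ?i - b ?i * G (Suc ?i) = (b 0 - \<mu>) * G ?i"
      using G_eigen[OF D_le[OF y x]] by (simp add: algebra_simps)
    finally show ?thesis by (simp add: g_def)
  qed
  define M where "M y z = (\<Sum>x\<in>V. g (D y x) * g (D x z))" for y z
  have "radial (\<lambda>x z. g (D x z))" unfolding radial_def by blast
  then have "radial M" unfolding M_def by (rule radial_product)
  then obtain H where H: "\<And>y z. y \<in> V \<Longrightarrow> z \<in> V \<Longrightarrow> M y z = H (D y z)"
    unfolding radial_def by blast
  have M_swap: "M y z = (\<Sum>x\<in>V. g (D y x) * g (D z x))" if "z \<in> V" for y z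
    unfolding M_def using that by (intro sum.cong) (auto simp: D_commute)
  have edge: "b 0 * H 1 = (b 0 - \<mu>) * H 0"
  proof -
    have u: "u \<in> V" by fact
    have "(\<Sum>w\<in>N u. M w u) = (\<Sum>w\<in>N u. H 1)"
      using u N_subset[OF u] in_N_iff[OF u] by (intro sum.cong) (auto simp: H D_commute)
    also have "\<dots> = b 0 * H 1" using card_N[OF u] by simp
    finally have "b 0 * H 1 = (\<Sum>w\<in>N u. M w u)" ..
    also have "\<dots> = (\<Sum>x\<in>V. (\<Sum>w\<in>N u. g (D w x)) * g (D x u))"
      unfolding M_def by (subst sum.swap) (simp add: sum_distrib_right)
    also have "\<dots> = (\<Sum>x\<in>V. (b 0 - \<mu>) * (g (D u x) * g (D x u)))"
      using g_eigen[OF u] by (intro sum.cong) auto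
    also have "\<dots> = (b 0 - \<mu>) * M u u" by (simp add: M_def sum_distrib_left)
    finally show ?thesis using H[OF u u] D_self[OF u] by simp
  qed
  define F where "F x w = g (D (\<phi> w) x)" for x w
  have F_def': "F x = (\<lambda>w. g (D (\<phi> w) x))" for x by (simp add: F_def fun_eq_iff)
  have L_F: "\<mu> * F x w - laplacian (F x) w = (\<Sum>w'\<in>N w. F x w') - (b 0 - \<mu>) * F x w" for x w
    by (simp add: laplacian_def algebra_simps)
  have "(\<Sum>x\<in>V. \<mu> * ip (F x) (F x) - ip (F x) (laplacian (F x)))
      = (\<Sum>x\<in>V. \<Sum>w\<in>V. F x w * (\<mu> * F x w - laplacian (F x) w))"
    by (simp add: ip_def sum_subtractf right_diff_distrib sum_distrib_left mult_ac)
  also have "\<dots> = (\<Sum>w\<in>V. \<Sum>x\<in>V. F x w * (\<mu> * F x w - laplacian (F x) w))"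
    by (rule sum.swap)
  also have "\<dots> = (\<Sum>w\<in>V. 0)"
  proof (rule sum.cong[OF refl])
    fix w assume w: "w \<in> V"
    have "(\<Sum>x\<in>V. F x w * (\<mu> * F x w - laplacian (F x) w))
      = (\<Sum>x\<in>V. \<Sum>w'\<in>N w. F x w * F x w') - (b 0 - \<mu>) * (\<Sum>x\<in>V. F x w * F x w)"
      by (simp only: L_F) (simp add: right_diff_distrib sum_subtractf sum_distrib_left mult_ac)
    also have "(\<Sum>x\<in>V. \<Sum>w'\<in>N w. F x w * F x w') = (\<Sum>w'\<in>N w. \<Sum>x\<in>V. F x w * F x w')"
      by (rule sum.swap)
    also have "\<dots> = (\<Sum>w'\<in>N w. M (\<phi> w) (\<phi> w'))"
      using w N_subset[OF w] \<phi>_V by (intro sum.cong refl) (simp add: M_swap F_def subset_iff)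
    also have "\<dots> = (\<Sum>w'\<in>N w. H 1)"
      using w N_subset[OF w] \<phi>_V \<phi>_N in_N_iff by (intro sum.cong refl) (auto simp: H)
    also have "\<dots> = b 0 * H 1" using card_N[OF w] by simp
    also have "(\<Sum>x\<in>V. F x w * F x w) = M (\<phi> w) (\<phi> w)"
      using w \<phi>_V by (simp add: M_swap F_def)
    also have "\<dots> = H 0" using H \<phi>_V[OF w] D_self by simp
    finally show "(\<Sum>x\<in>V. F x w * (\<mu> * F x w - laplacian (F x) w)) = 0" using edge by simp
  qed
  finally have "(\<Sum>x\<in>V. \<mu> * ip (F x) (F x) - ip (F x) (laplacian (F x))) = 0" by simp
  then have "\<mu> * ip (F x) (F x) - ip (F x) (laplacian (F x)) = 0"
    using rayleigh_bound finite_V \<open>x \<in> V\<close> by (subst (asm) sum_nonneg_eq_0_iff) auto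
  then have "laplacian (F x) u = \<mu> * F x u" using rayleigh_equality[of "F x" u] \<open>u \<in> V\<close> by simp
  then show ?thesis using L_F[of x u] by (simp add: F_def)
qed

end

text \<open>
  For the matrix of the Laplacian on radial functions, stripped of its signs, the positive eigenvector
  exists; putting the signs back makes consecutive entries of \<open>g\<close> different.
\<close>
lemma exists_alternating_eigenvector:
  obtains g :: "nat \<Rightarrow> real" and \<theta> where
    "\<And>i. i < d \<Longrightarrow> g i \<noteq> g (Suc i)"
    "\<And>\<phi> u x. (\<And>u. u \<in> V \<Longrightarrow> \<phi> u \<in> V) \<Longrightarrow> (\<And>u w. u \<in> V \<Longrightarrow> w \<in> N u \<Longrightarrow> \<phi> w \<in> N (\<phi> u)) \<Longrightarrow>
      u \<in> V \<Longrightarrow> x \<in> V \<Longrightarrow> (\<Sum>w\<in>N u. g (D (\<phi> w) x)) = \<theta> * g (D (\<phi> u) x)"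
proof -
  obtain \<mu> G where G: "G 0 = 1" "\<And>i. i \<le> d \<Longrightarrow> 0 < G i"
    "\<And>i. i \<le> d \<Longrightarrow> real (c i) * G (i - 1) + (b 0 - a i) * G i + real (b i) * G (Suc i) = \<mu> * G i"
  proof (rule jacobi_positive_eigenvector[of d "\<lambda>i. real (b i)" "\<lambda>i. real (c i)" "\<lambda>i. b 0 - a i"])
  qed (use b_pos b_d c_pos c_0 in auto)
  let ?g = "\<lambda>i. (- 1) ^ i * G i"
  show ?thesis
  proof
    show "?g i \<noteq> ?g (Suc i)" if "i < d" for i
    proof -
      have "0 < G i + G (Suc i)" using G(2)[of i] G(2)[of "Suc i"] that by simp
      then show ?thesis by (cases "even i") auto
    qed
    show "(\<Sum>w\<in>N u. ?g (D (\<phi> w) x)) = (b 0 - \<mu>) * ?g (D (\<phi> u) x)"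
      if "\<And>u. u \<in> V \<Longrightarrow> \<phi> u \<in> V" "\<And>u w. u \<in> V \<Longrightarrow> w \<in> N u \<Longrightarrow> \<phi> w \<in> N (\<phi> u)"
        "u \<in> V" "x \<in> V" for \<phi> u x
      using eigenvector_pullback[OF G that(1,2) that(4,3)] by simp
  qed
qed

section \<open>Homomorphisms that keep an antipodal pair\<close>

lemma hom_nonexpanding:
  assumes \<phi>_V: "\<And>u. u \<in> V \<Longrightarrow> \<phi> u \<in> V"
    and \<phi>_N: "\<And>u w. u \<in> V \<Longrightarrow> w \<in> N u \<Longrightarrow> \<phi> w \<in> N (\<phi> u)"
    and "u \<in> V" "v \<in> V"
  shows "D (\<phi> u) (\<phi> v) \<le> D u v"
  using assms(4)
proof (induction "D u v" arbitrary: v)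
  case 0
  then show ?case using D_eq_0_iff[OF assms(3)] D_self \<phi>_V by simp
next
  case (Suc n)
  then obtain w where w: "w \<in> N v" "D u w = n" using D_predecessor[OF assms(3)] by metis
  then have wV: "w \<in> V" using N_subset Suc.prems by blast
  have "D (\<phi> u) (\<phi> v) \<le> D (\<phi> u) (\<phi> w) + 1"
    using D_neighbour(1)[of "\<phi> u" "\<phi> w" "\<phi> v"] \<phi>_N[OF wV] \<phi>_V wV w(1) N_sym assms(3) Suc.prems
    by blast
  also have "\<dots> \<le> n + 1" using Suc.hyps(1)[of w] w wV by simp
  finally show ?case using Suc.hyps(2) by simp
qed

text \<open>
  The eigenvector equation at \<open>u\<close> is applied to \<open>\<phi>\<close> and to the identity. In both cases it has only the two
  values \<open>g (d - 1)\<close> and \<open>g d\<close> on its left-hand side and \<open>\<theta> * g d\<close> on its right-hand side, so \<open>g (d - 1)\<close> occurs equally often.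
\<close>
lemma hom_keeps_antipodal_neighbours:
  assumes \<phi>_V: "\<And>u. u \<in> V \<Longrightarrow> \<phi> u \<in> V"
    and \<phi>_N: "\<And>u w. u \<in> V \<Longrightarrow> w \<in> N u \<Longrightarrow> \<phi> w \<in> N (\<phi> u)"
    and "1 \<le> d" and v: "v \<in> V" and u: "u \<in> V"
    and uv: "D v u = d" "D (\<phi> v) (\<phi> u) = d"
    and w: "w \<in> N u" "D v w = d"
  shows "D (\<phi> v) (\<phi> w) = d"
proof -
  obtain g :: "nat \<Rightarrow> real" and \<theta> where g: "\<And>i. i < d \<Longrightarrow> g i \<noteq> g (Suc i)"
    and pullback: "\<And>\<phi> u x. (\<And>u. u \<in> V \<Longrightarrow> \<phi> u \<in> V) \<Longrightarrow> (\<And>u w. u \<in> V \<Longrightarrow> w \<in> N u \<Longrightarrow> \<phi> w \<in> N (\<phi> u)) \<Longrightarrow>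
      u \<in> V \<Longrightarrow> x \<in> V \<Longrightarrow> (\<Sum>w\<in>N u. g (D (\<phi> w) x)) = \<theta> * g (D (\<phi> u) x)"
    using exists_alternating_eigenvector by blast
  have gd: "g (d - 1) \<noteq> g d" using g[of "d - 1"] \<open>1 \<le> d\<close> by simp
  have fin: "finite (N u)" using finite_N[OF u] .
  have count: "(\<Sum>w\<in>N u. g (D (\<psi> w) (\<psi> v))) = b 0 * g d + card {w \<in> N u. D (\<psi> v) (\<psi> w) = d - 1} * (g (d - 1) - g d)"
    if \<psi>_V: "\<And>u. u \<in> V \<Longrightarrow> \<psi> u \<in> V" and \<psi>_N: "\<And>u w. u \<in> V \<Longrightarrow> w \<in> N u \<Longrightarrow> \<psi> w \<in> N (\<psi> u)"
      and \<psi>_uv: "D (\<psi> v) (\<psi> u) = d" for \<psi>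
  proof -
    have "g (D (\<psi> w) (\<psi> v)) = g d + of_bool (D (\<psi> v) (\<psi> w) = d - 1) * (g (d - 1) - g d)"
      if "w \<in> N u" for w
    proof -
      have wV: "w \<in> V" using N_subset[OF u] that by blast
      have "d \<le> D (\<psi> v) (\<psi> w) + 1"
        using D_neighbour(2)[OF \<psi>_V[OF v] \<psi>_V[OF u] \<psi>_N[OF u that]] \<psi>_uv by simp
      moreover have "D (\<psi> v) (\<psi> w) \<le> d" using D_le \<psi>_V v wV by blast
      ultimately have "D (\<psi> v) (\<psi> w) = d \<or> D (\<psi> v) (\<psi> w) = d - 1" by linarith
      then show ?thesis using D_commute[OF \<psi>_V[OF v] \<psi>_V[OF wV]] \<open>1 \<le> d\<close> by auto
    qed
    then have "(\<Sum>w\<in>N u. g (D (\<psi> w) (\<psi> v)))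
        = (\<Sum>w\<in>N u. g d + of_bool (D (\<psi> v) (\<psi> w) = d - 1) * (g (d - 1) - g d))"
      by (rule sum.cong[OF refl])
    also have "\<dots> = b 0 * g d + (\<Sum>w\<in>N u. of_bool (D (\<psi> v) (\<psi> w) = d - 1)) * (g (d - 1) - g d)"
      using card_N[OF u] by (simp add: sum.distrib sum_distrib_right)
    also have "(\<Sum>w\<in>N u. of_bool (D (\<psi> v) (\<psi> w) = d - 1)) = real (card {w \<in> N u. D (\<psi> v) (\<psi> w) = d - 1})"
      using fin by (simp add: Int_def)
    finally show ?thesis .
  qed
  let ?A = "{w \<in> N u. D v w = d - 1}" and ?B = "{w \<in> N u. D (\<phi> v) (\<phi> w) = d - 1}"
  have "real (card ?A) * (g (d - 1) - g d) = \<theta> * g d - b 0 * g d"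
    using count[of "\<lambda>x. x"] pullback[of "\<lambda>x. x" u v] u v uv D_commute[OF u v] by simp
  moreover have "real (card ?B) * (g (d - 1) - g d) = \<theta> * g d - b 0 * g d"
    using count[of \<phi>] pullback[of \<phi> u "\<phi> v"] \<phi>_V \<phi>_N u v uv D_commute[of "\<phi> u" "\<phi> v"] by simp
  ultimately have "card ?A = card ?B" using gd
    by (metis (no_types, lifting) mult_cancel_right of_nat_eq_iff right_minus_eq)
  \<comment> \<open>Homomorphisms do not increase distances, and the image of a neighbour of \<open>u\<close> is adjacent to
    \<open>\<phi> u\<close>, at distance \<open>d\<close> from \<open>\<phi> v\<close>.\<close>
  moreover have "?A \<subseteq> ?B"
  proof
    fix x assume x: "x \<in> ?A"
    then have xV: "x \<in> V" using N_subset[OF u] by blast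
    have "D (\<phi> v) (\<phi> x) \<le> d - 1"
      using hom_nonexpanding[of \<phi> v x] \<phi>_V \<phi>_N v xV x by simp
    moreover have "d \<le> D (\<phi> v) (\<phi> x) + 1"
      using D_neighbour(2)[OF \<phi>_V[OF v] \<phi>_V[OF u] \<phi>_N[OF u, of x]] x uv by simp
    ultimately show "x \<in> ?B" using x by auto
  qed
  ultimately have "?A = ?B" using fin by (intro card_subset_eq) auto
  moreover have "w \<notin> ?A" using w \<open>1 \<le> d\<close> by simp
  ultimately have "D (\<phi> v) (\<phi> w) \<noteq> d - 1" using w(1) by blast
  moreover have wV: "w \<in> V" using N_subset[OF u] w by blast
  moreover have "d \<le> D (\<phi> v) (\<phi> w) + 1"
    using D_neighbour(2)[OF \<phi>_V[OF v] \<phi>_V[OF u] \<phi>_N[OF u w(1)]] uv by simp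
  ultimately show ?thesis using D_le[OF \<phi>_V[OF v] \<phi>_V[OF wV]] by linarith
qed

text \<open>
  Antipodal pairs stay antipodal along a sphere of radius \<open>d\<close> and then along the distance-\<open>d\<close> graph.
  For arbitrary \<open>u\<close> and \<open>v\<close>, a geodesic from \<open>u\<close> through \<open>v\<close> to an antipode \<open>w\<close> of \<open>u\<close> cannot be
  shortened between \<open>u\<close> and \<open>v\<close>, since its total length is kept and no part of it grows.
\<close>
lemma hom_isometry:
  assumes \<phi>_V: "\<And>u. u \<in> V \<Longrightarrow> \<phi> u \<in> V"
    and \<phi>_N: "\<And>u w. u \<in> V \<Longrightarrow> w \<in> N u \<Longrightarrow> \<phi> w \<in> N (\<phi> u)"
    and "1 \<le> d"
    and sphere: "\<And>v. v \<in> V \<Longrightarrow> linked {w \<in> V. D v w = d} (\<lambda>x y. y \<in> N x)"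
    and antipodal: "linked V (\<lambda>x y. D x y = d)"
    and start: "x \<in> V" "y \<in> V" "D x y = d" "D (\<phi> x) (\<phi> y) = d"
    and "u \<in> V" "v \<in> V"
  shows "D (\<phi> u) (\<phi> v) = D u v"
proof -
  have sphere_kept: "D (\<phi> v) (\<phi> w) = d"
    if v: "v \<in> V" and u: "u \<in> V" "D v u = d" "D (\<phi> v) (\<phi> u) = d" and w: "w \<in> V" "D v w = d" for u v w
  proof (rule linked_induct[OF sphere[OF v], where P = "\<lambda>w. D (\<phi> v) (\<phi> w) = d"])
    show "u \<in> {w \<in> V. D v w = d}" "w \<in> {w \<in> V. D v w = d}" using u w by auto
    show "D (\<phi> v) (\<phi> u) = d" by fact
    show "D (\<phi> v) (\<phi> z) = d"
      if "y \<in> {w \<in> V. D v w = d}" "z \<in> {w \<in> V. D v w = d}" "D (\<phi> v) (\<phi> y) = d" "z \<in> N y" for y z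
      by (rule hom_keeps_antipodal_neighbours[of \<phi> v y z]) (use \<phi>_V \<phi>_N \<open>1 \<le> d\<close> v that in auto)
  qed
  have all_kept: "\<forall>w\<in>V. D v w = d \<longrightarrow> D (\<phi> v) (\<phi> w) = d" if "v \<in> V" for v
  proof (rule linked_induct[OF antipodal \<open>x \<in> V\<close>,
        where P = "\<lambda>v. \<forall>w\<in>V. D v w = d \<longrightarrow> D (\<phi> v) (\<phi> w) = d"])
    show "\<forall>w\<in>V. D x w = d \<longrightarrow> D (\<phi> x) (\<phi> w) = d" using sphere_kept[OF start(1,2,3,4)] by blast
    show "\<forall>w\<in>V. D z w = d \<longrightarrow> D (\<phi> z) (\<phi> w) = d"
      if "y \<in> V" "z \<in> V" "\<forall>w\<in>V. D y w = d \<longrightarrow> D (\<phi> y) (\<phi> w) = d" "D y z = d" for y z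
    proof -
      have "D z y = d" "D (\<phi> z) (\<phi> y) = d" using that D_commute \<phi>_V by auto
      then show ?thesis using sphere_kept[OF that(2,1)] by blast
    qed
  qed fact
  obtain w where w: "w \<in> V" "D u w = d" "D v w = d - D u v"
    using antipode_extension[OF \<open>u \<in> V\<close> \<open>v \<in> V\<close>] by blast
  have "d = D (\<phi> u) (\<phi> w)" using all_kept w \<open>u \<in> V\<close> by simp
  also have "\<dots> \<le> D (\<phi> u) (\<phi> v) + D (\<phi> v) (\<phi> w)"
    using D_triangle \<phi>_V \<open>u \<in> V\<close> \<open>v \<in> V\<close> w by blast
  finally have "d \<le> D (\<phi> u) (\<phi> v) + D (\<phi> v) (\<phi> w)" .
  moreover have "D (\<phi> v) (\<phi> w) \<le> d - D u v"
    using hom_nonexpanding[of \<phi> v w] \<phi>_V \<phi>_N \<open>v \<in> V\<close> w by simp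
  moreover have "D (\<phi> u) (\<phi> v) \<le> D u v"
    using hom_nonexpanding[of \<phi> u v] \<phi>_V \<phi>_N \<open>u \<in> V\<close> \<open>v \<in> V\<close> by simp
  ultimately show ?thesis
    using D_le[OF \<open>u \<in> V\<close> \<open>v \<in> V\<close>] by linarith
qed

end

section \<open>Graph distance as a path metric\<close>

text \<open>
  With walks as powers of the arc relation, composing, reversing and mapping walks become
  computations with relations.
\<close>
lemma awalk_length_iff_relpow:
  assumes "pair_wf_digraph X" "u \<in> pverts X"
  shows "(\<exists>p. pre_digraph.awalk (with_proj X) u p v \<and> length p = n) \<longleftrightarrow> (u, v) \<in> parcs X ^^ n"
proof -
  interpret pair_wf_digraph X by fact
  show ?thesis
    using assms(2)
  proof (induction n arbitrary: u)
    case 0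
    then show ?case by (auto simp: awalk_Nil_iff)
  next
    case (Suc n)
    have "(\<exists>p. awalk u p v \<and> length p = Suc n) \<longleftrightarrow>
        (\<exists>w. (u, w) \<in> parcs X \<and> (\<exists>p. awalk w p v \<and> length p = n))"
    proof
      assume "\<exists>p. awalk u p v \<and> length p = Suc n"
      then obtain e q where "awalk u (e # q) v" "length q = n" by (auto simp: length_Suc_conv)
      then show "\<exists>w. (u, w) \<in> parcs X \<and> (\<exists>p. awalk w p v \<and> length p = n)"
        by (intro exI[of _ "snd e"]) (auto simp: awalk_Cons_iff)
    next
      assume "\<exists>w. (u, w) \<in> parcs X \<and> (\<exists>p. awalk w p v \<and> length p = n)"
      then obtain w q where "(u, w) \<in> parcs X" "awalk w q v" "length q = n" by blast
      then show "\<exists>p. awalk u p v \<and> length p = Suc n"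
        by (intro exI[of _ "(u, w) # q"]) (simp add: awalk_Cons_iff)
    qed
    also have "\<dots> \<longleftrightarrow> (\<exists>w. (u, w) \<in> parcs X \<and> (w, v) \<in> parcs X ^^ n)"
      using Suc.IH in_arcsD2 by blast
    also have "\<dots> \<longleftrightarrow> (u, v) \<in> parcs X ^^ Suc n"
      unfolding relpow.simps(2) relpow_commute[symmetric] by blast
    finally show ?case .
  qed
qed

lemma gdist_le_iff:
  assumes "pair_wf_digraph X" "u \<in> pverts X"
  shows "gdist X u v \<le> enat n \<longleftrightarrow> (\<exists>m\<le>n. (u, v) \<in> parcs X ^^ m)"
proof
  let ?A = "{p. pre_digraph.awalk (with_proj X) u p v}"
  assume le: "gdist X u v \<le> enat n"
  have ne: "(\<lambda>p. enat (length p)) ` ?A \<noteq> {}"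
  proof
    assume "(\<lambda>p. enat (length p)) ` ?A = {}"
    then have "gdist X u v = \<infinity>" by (simp add: gdist_def Inf_enat_def)
    then show False using le by simp
  qed
  have "gdist X u v \<in> (\<lambda>p. enat (length p)) ` ?A"
    unfolding gdist_def Inf_enat_def if_not_P[OF ne] by (rule LeastI_ex) (use ne in blast)
  then obtain p where "p \<in> ?A" "gdist X u v = enat (length p)" by auto
  then show "\<exists>m\<le>n. (u, v) \<in> parcs X ^^ m"
    using le awalk_length_iff_relpow[OF assms, of v "length p"] by auto
next
  assume "\<exists>m\<le>n. (u, v) \<in> parcs X ^^ m"
  then obtain m p where "m \<le> n" "pre_digraph.awalk (with_proj X) u p v" "length p = m"
    using awalk_length_iff_relpow[OF assms] by metis
  then show "gdist X u v \<le> enat n" unfolding gdist_def by (intro INF_lower2[of p]) auto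
qed

lemma gdist_mono_hom:
  assumes "pair_wf_digraph X" "pair_wf_digraph Y" "graph_hom X Y f" "u \<in> pverts X"
  shows "gdist Y (f u) (f v) \<le> gdist X u v"
proof (cases "gdist X u v")
  case (enat n)
  then obtain m where m: "m \<le> n" "(u, v) \<in> parcs X ^^ m"
    using gdist_le_iff[OF assms(1,4), of v n] by auto
  have "(f u, f v) \<in> parcs Y ^^ m"
    using m(2)
  proof (induction m arbitrary: v)
    case (Suc m)
    then obtain w where "(f u, f w) \<in> parcs Y ^^ m" "(w, v) \<in> parcs X" by auto
    then show ?case using assms(3) by (auto simp: graph_hom_def)
  qed simp
  moreover have "f u \<in> pverts Y" using assms by (auto simp: graph_hom_def)
  ultimately show ?thesis using gdist_le_iff[OF assms(2), of "f u" "f v" n] m(1) enat by auto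
qed simp

lemma gdiameter_attained:
  assumes "finite (pverts X)" "pverts X \<noteq> {}"
  obtains u v where "u \<in> pverts X" "v \<in> pverts X" "gdist X u v = gdiameter X"
proof -
  let ?V = "pverts X"
  have "\<exists>v\<in>?V. (SUP v\<in>?V. gdist X u v) = gdist X u v" for u
  proof -
    have "(SUP v\<in>?V. gdist X u v) \<in> gdist X u ` ?V"
      using assms by (simp add: Sup_enat_def)
    then show ?thesis by auto
  qed
  then obtain v where v: "\<And>u. v u \<in> ?V" "\<And>u. (SUP v\<in>?V. gdist X u v) = gdist X u (v u)"
    by metis
  have "gdiameter X \<in> (\<lambda>u. SUP v\<in>?V. gdist X u v) ` ?V"
    unfolding gdiameter_def using assms by (subst Sup_enat_def) auto
  then obtain u where "u \<in> ?V" "gdiameter X = gdist X u (v u)" using v(2) by auto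
  then show ?thesis using that v(1) by metis
qed

lemma gdist_le_gdiameter:
  "u \<in> pverts X \<Longrightarrow> v \<in> pverts X \<Longrightarrow> gdist X u v \<le> gdiameter X"
  unfolding gdiameter_def by (rule SUP_upper2[of u], assumption, rule SUP_upper)

text \<open>
  The finite diameter makes all distances finite, so they may be read as natural numbers.
\<close>
lemma distance_regular_space_gdist:
  assumes dr: "distance_regular X" and diam: "gdiameter X = enat d"
  obtains b c where
    "distance_regular_space (pverts X) (gneighbours X) (\<lambda>u v. the_enat (gdist X u v)) b c d"
    "\<And>u v. u \<in> pverts X \<Longrightarrow> v \<in> pverts X \<Longrightarrow> gdist X u v = enat (the_enat (gdist X u v))"
proof -
  from dr obtain b c where pg: "pair_graph X" and conn: "Digraph_Component.connected (with_proj X)"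
    and bc: "\<And>i u v. u \<in> pverts X \<Longrightarrow> v \<in> pverts X \<Longrightarrow> gdist X u v = enat i \<Longrightarrow>
        card {w \<in> gneighbours X v. gdist X u w + 1 = enat i} = c i \<and>
        card {w \<in> gneighbours X v. gdist X u w = enat (i + 1)} = b i"
    unfolding distance_regular_def by blast
  interpret pair_graph X by fact
  have wf: "pair_wf_digraph X" by unfold_locales
  let ?V = "pverts X" and ?R = "parcs X" and ?D = "\<lambda>u v. the_enat (gdist X u v)"
  have fin: "gdist X u v = enat (?D u v)" if "u \<in> ?V" "v \<in> ?V" for u v
    using gdist_le_gdiameter[OF that] diam by (cases "gdist X u v") auto
  have D_le_iff: "?D u v \<le> n \<longleftrightarrow> (\<exists>m\<le>n. (u, v) \<in> ?R ^^ m)" if "u \<in> ?V" "v \<in> ?V" for u v n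
    using gdist_le_iff[OF wf that(1), of v n] fin[OF that] by (metis enat_ord_simps(1))
  have D_relpow: "(u, v) \<in> ?R ^^ ?D u v" if uv: "u \<in> ?V" "v \<in> ?V" for u v
  proof -
    obtain m where m: "m \<le> ?D u v" "(u, v) \<in> ?R ^^ m" using D_le_iff[OF uv] by blast
    then have "?D u v \<le> m" using D_le_iff[OF uv] by blast
    then show ?thesis using m by simp
  qed
  have D_leI: "?D u v \<le> n" if "u \<in> ?V" "v \<in> ?V" "(u, v) \<in> ?R ^^ n" for u v n
    using D_le_iff that by blast
  have sym_R: "?R\<inverse> = ?R" using pair_sym_arcs by (auto simp: symmetric_def sym_def)
  have sym_pow: "(u, v) \<in> ?R ^^ n \<Longrightarrow> (v, u) \<in> ?R ^^ n" for u v n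
  proof (induction n arbitrary: v)
    case (Suc n)
    then obtain w where "(u, w) \<in> ?R ^^ n" "(w, v) \<in> ?R" by auto
    then have "(w, u) \<in> ?R ^^ n" "(v, w) \<in> ?R" using Suc.IH sym_R by auto
    then show ?case by (rule relpow_Suc_I2[rotated])
  qed simp
  have D_sym: "?D u v = ?D v u" if "u \<in> ?V" "v \<in> ?V" for u v
    using D_leI[OF that sym_pow[OF D_relpow]] D_leI[OF that(2,1) sym_pow[OF D_relpow]] that
    by (simp add: antisym)
  have arc_V: "u \<in> ?V" "v \<in> ?V" if "(u, v) \<in> ?R" for u v
    using that in_arcsD1 in_arcsD2 by auto
  have zero: "?D u v = 0 \<longleftrightarrow> u = v" if "u \<in> ?V" "v \<in> ?V" for u v
    using D_relpow[OF that] D_leI[OF that, of 0] by auto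
  have one: "?D u v = 1 \<longleftrightarrow> (u, v) \<in> ?R" if "u \<in> ?V" "v \<in> ?V" for u v
  proof
    assume "?D u v = 1"
    then show "(u, v) \<in> ?R" using D_relpow[OF that] by simp
  next
    assume "(u, v) \<in> ?R"
    then have "?D u v \<le> 1" "u \<noteq> v" using D_leI[OF that, of 1] no_loops' by auto
    then show "?D u v = 1" using zero[OF that] by linarith
  qed
  have N_V: "gneighbours X v \<subseteq> ?V" for v using arc_V by (auto simp: gneighbours_def)
  have "distance_regular_space ?V (gneighbours X) ?D b c d"
  proof
    show "finite ?V" by simp
    show "gneighbours X v \<subseteq> ?V" for v by (rule N_V)
    show "?D u v = 0 \<longleftrightarrow> u = v" if "u \<in> ?V" "v \<in> ?V" for u v by (rule zero[OF that])
    show "?D u v = ?D v u" if "u \<in> ?V" "v \<in> ?V" for u v by (rule D_sym[OF that])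
    show "?D u w \<le> ?D u v + ?D v w" if "u \<in> ?V" "v \<in> ?V" "w \<in> ?V" for u v w
      using D_leI[of u w "?D u v + ?D v w"] D_relpow that by (auto simp: relpow_add)
    show "?D u v = 1 \<longleftrightarrow> v \<in> gneighbours X u" if "u \<in> ?V" "v \<in> ?V" for u v
      using one[OF that] by (simp add: gneighbours_def)
    show "\<exists>w\<in>gneighbours X v. ?D u w = i" if uv: "u \<in> ?V" "v \<in> ?V" "?D u v = Suc i" for u v i
    proof -
      obtain w where w: "(u, w) \<in> ?R ^^ i" "(w, v) \<in> ?R" using D_relpow[OF uv(1,2)] uv(3) by auto
      then have wV: "w \<in> ?V" and vw: "(v, w) \<in> ?R" using arc_V sym_R by auto
      have "?D u w \<le> i" using D_leI[OF uv(1) wV w(1)] .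
      moreover have "Suc i \<le> Suc (?D u w)"
        using D_leI[of u v "Suc (?D u w)"] D_relpow[OF uv(1) wV] w(2) uv by auto
      ultimately show ?thesis using vw by (auto simp: gneighbours_def)
    qed
    show "card {w \<in> gneighbours X v. ?D u w + 1 = ?D u v} = c (?D u v)" if "u \<in> ?V" "v \<in> ?V" for u v
    proof -
      have "?D u w + 1 = ?D u v \<longleftrightarrow> gdist X u w + 1 = enat (?D u v)" if wN: "w \<in> gneighbours X v" for w
      proof -
        obtain n where "gdist X u w = enat n" using fin[OF \<open>u \<in> ?V\<close>, of w] wN N_V by blast
        then show ?thesis by (simp add: one_enat_def)
      qed
      then have "{w \<in> gneighbours X v. ?D u w + 1 = ?D u v}
          = {w \<in> gneighbours X v. gdist X u w + 1 = enat (?D u v)}" by blast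
      then show ?thesis using bc[OF that fin[OF that]] by simp
    qed
    show "card {w \<in> gneighbours X v. ?D u w = ?D u v + 1} = b (?D u v)" if "u \<in> ?V" "v \<in> ?V" for u v
    proof -
      have "?D u w = ?D u v + 1 \<longleftrightarrow> gdist X u w = enat (?D u v + 1)" if wN: "w \<in> gneighbours X v" for w
      proof -
        obtain n where "gdist X u w = enat n" using fin[OF \<open>u \<in> ?V\<close>, of w] wN N_V by blast
        then show ?thesis by simp
      qed
      then have "{w \<in> gneighbours X v. ?D u w = ?D u v + 1}
          = {w \<in> gneighbours X v. gdist X u w = enat (?D u v + 1)}" by blast
      then show ?thesis using bc[OF that fin[OF that]] by simp
    qed
    show "?D u v \<le> d" if "u \<in> ?V" "v \<in> ?V" for u v
      using gdist_le_gdiameter[OF that] diam fin[OF that] by (metis enat_ord_simps(1))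
    have "?V \<noteq> {}" using conn by (auto simp: Digraph_Component.connected_def strongly_connected_def)
    then obtain u v where "u \<in> ?V" "v \<in> ?V" "gdist X u v = gdiameter X"
      by (rule gdiameter_attained[OF pair_finite_verts])
    then show "\<exists>u\<in>?V. \<exists>v\<in>?V. ?D u v = d"
      using diam by (intro bexI[of _ u] bexI[of _ v]) simp_all
  qed
  then show ?thesis using that fin by blast
qed

section \<open>Retractions onto subgraphs of full diameter\<close>

theorem theorem5p3:
  fixes X Y :: "'a pair_pre_digraph" and d :: nat and \<phi> :: "'a \<Rightarrow> 'a"
  assumes "primitive_distance_regular X"
    and "gdiameter X = enat d"
    and "\<And>v. v \<in> pverts X \<Longrightarrow>
           Digraph_Component.connected (induce_subgraph (with_proj X) (gsphere X d v))"
    and "graph_retraction X Y \<phi>"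
    and "gdiameter Y = enat d"
  shows "graph_automorphism X \<phi>"
proof -
  have dr: "distance_regular X" using assms(1) by (simp add: primitive_distance_regular_def)
  obtain b c where space:
      "distance_regular_space (pverts X) (gneighbours X) (\<lambda>u v. the_enat (gdist X u v)) b c d"
    and fin: "\<And>u v. u \<in> pverts X \<Longrightarrow> v \<in> pverts X \<Longrightarrow> gdist X u v = enat (the_enat (gdist X u v))"
    using distance_regular_space_gdist[OF dr assms(2)] by blast
  let ?D = "\<lambda>u v. the_enat (gdist X u v)"
  interpret X: distance_regular_space "pverts X" "gneighbours X" ?D b c d by (rule space)
  interpret G: pair_graph X using dr by (simp add: distance_regular_def)
  interpret Y: pair_graph Y using assms(4) by (simp add: graph_retraction_def)
  have wf: "pair_wf_digraph X" "pair_wf_digraph Y" by unfold_locales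
  have Y_sub: "pverts Y \<subseteq> pverts X" "parcs Y \<subseteq> parcs X"
    using assms(4) by (auto simp: graph_retraction_def subgraph_def)
  have hom: "graph_hom X Y \<phi>" and fixes_Y: "\<And>y. y \<in> pverts Y \<Longrightarrow> \<phi> y = y"
    using assms(4) by (auto simp: graph_retraction_def)
  have inclusion: "graph_hom Y X (\<lambda>y. y)" using Y_sub by (auto simp: graph_hom_def)
  have \<phi>_V: "\<phi> u \<in> pverts X" if "u \<in> pverts X" for u
    using hom Y_sub that by (auto simp: graph_hom_def)
  have \<phi>_N: "\<phi> w \<in> gneighbours X (\<phi> u)" if "w \<in> gneighbours X u" for u w
    using hom Y_sub that by (auto simp: graph_hom_def gneighbours_def)
  obtain x0 where "x0 \<in> pverts X" using X.D_attained by blast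
  then have "pverts Y \<noteq> {}" using hom by (auto simp: graph_hom_def)
  then obtain x y where xy: "x \<in> pverts Y" "y \<in> pverts Y" "gdist Y x y = enat d"
    using gdiameter_attained[of Y] assms(5) by auto
  \<comment> \<open>The inclusion of \<open>Y\<close> and the retraction are both homomorphisms, so neither distance exceeds
    the other.\<close>
  have "gdist X x y = enat d"
  proof (rule antisym)
    show "gdist X x y \<le> enat d"
      using gdist_mono_hom[OF wf(2,1) inclusion xy(1), of y] xy(3) by simp
    show "enat d \<le> gdist X x y"
      using gdist_mono_hom[OF wf hom, of x y] fixes_Y xy Y_sub by auto
  qed
  then have xy_D: "?D x y = d" "?D (\<phi> x) (\<phi> y) = d" using fixes_Y xy by auto
  have xy_X: "x \<in> pverts X" "y \<in> pverts X" using xy Y_sub by auto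
  have isometry: "?D (\<phi> u) (\<phi> v) = ?D u v" if uv: "u \<in> pverts X" "v \<in> pverts X" for u v
  \<comment> \<open>If \<open>d = 0\<close>, there is one vertex only, and no \<open>X\<^sub>d\<close> to spread along.\<close>
  proof (cases "1 \<le> d")
    case False
    then have "?D u v = 0" "?D (\<phi> u) (\<phi> v) = 0"
      using X.D_le[OF uv] X.D_le[OF \<phi>_V \<phi>_V, OF uv] by auto
    then show ?thesis by simp
  next
    case True
    have sphere: "linked {w \<in> pverts X. ?D v w = d} (\<lambda>x y. y \<in> gneighbours X x)"
      if v: "v \<in> pverts X" for v
    proof -
      have "{w \<in> pverts X. ?D v w = d} = gsphere X d v"
        unfolding gsphere_def
      proof (rule Collect_cong, intro conj_cong refl)
        fix w assume "w \<in> pverts X"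
        then obtain n where "gdist X v w = enat n" using fin[OF v] by blast
        then show "?D v w = d \<longleftrightarrow> gdist X v w = enat d" by simp
      qed
      moreover have "linked (verts (induce_subgraph (with_proj X) (gsphere X d v)))
          (\<lambda>x y. y \<in> gneighbours X x)"
        using G.pair_sym_arcs
        by (intro linked_verts[OF assms(3)[OF v]])
          (auto simp: arcs_ends_conv gneighbours_def symmetric_def sym_def)
      ultimately show ?thesis by simp
    qed
    have "Digraph_Component.connected (with_proj (distance_graph X d))"
      using assms(1,2) True by (simp add: primitive_distance_regular_def)
    then have "linked (verts (with_proj (distance_graph X d))) (\<lambda>x y. ?D x y = d)"
      by (rule linked_verts) (auto simp: distance_graph_def arcs_ends_conv X.D_commute)
    then have antipodal: "linked (pverts X) (\<lambda>x y. ?D x y = d)" by (simp add: distance_graph_def)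
    show ?thesis
      by (rule X.hom_isometry[of \<phi> x y]) (use \<phi>_V \<phi>_N True sphere antipodal xy_X xy_D uv in auto)
  qed
  have inj: "inj_on \<phi> (pverts X)"
    using isometry X.D_eq_0_iff \<phi>_V by (metis inj_onI)
  have "\<phi> ` pverts X \<subseteq> pverts X" using \<phi>_V by blast
  then have "bij_betw \<phi> (pverts X) (pverts X)"
    using inj endo_inj_surj[OF X.finite_V] by (simp add: bij_betw_def)
  moreover have "(u, v) \<in> parcs X \<longleftrightarrow> (\<phi> u, \<phi> v) \<in> parcs X" if "u \<in> pverts X" "v \<in> pverts X" for u v
    using X.D_eq_1_iff[OF that] X.D_eq_1_iff[OF \<phi>_V \<phi>_V, OF that] isometry[OF that]
    by (simp add: gneighbours_def)
  ultimately show ?thesis by (simp add: graph_automorphism_def)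
qed

end
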